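(* If $\mathcal T$ is an FLD$_1$-theory having a VC$^\sharp$-decomposition, then $\mathcal T$ satisfies VC$^\sharp$, i.e. $I(\mathcal T)\in\{1,\mathfrak c\}$.
   Context: All structures are partial orders in the language $L_b=\langle\le\rangle$; $\mathfrak c=2^{\aleph_0}$. For a complete $L_b$-theory $\mathcal T$, $I(\mathcal T)$ is the number of non-isomorphic countable models; for a partial order $\mathbb X$, $I(\mathbb X):=I(\mathrm{Th}(\mathbb X))$, with $I(\mathbb X)=1$ when $\mathbb X$ is finite; $\mathbb X$ satisfies VC$^\sharp$ iff $I(\mathbb X)\in\{1,\mathfrak c\}$. Lexicographic sum: for a partial order $\mathbb I=\langle I,\le_{\mathbb I}\rangle$ and partial orders $\mathbb X_i$ ($i\in I$) with pairwise disjoint domains, $\sum_{\mathbb I}\mathbb X_i$ is the partial order on $\bigcup_i X_i$ with $x\le x'$ iff either $x,x'\in X_i$ and $x\le_{\mathbb X_i}x'$, or $x\in X_i$, $x'\in X_j$ with $i<_{\mathbb I}j$. A partial order $\mathbb X$ is FLD$_1$ iff $\mathbb X=\sum_{\mathbb I}\mathbb X_i$ for some finite partial order $\mathbb I$ and partition $\{X_i\}_{i\in I}$ of its domain (induced suborders $\mathbb X_i$) with each $\mathbb X_i$ having a largest element; this is an FLD$_1$ decomposition. A complete theory of partial order is an FLD$_1$-theory iff some (equivalently every) model is FLD$_1$. A VC$^\sharp$-decomposition of $\mathcal T$ is an FLD$_1$ decomposition $\sum_{\mathbb I}\mathbb X_i$ of some model of $\mathcal T$ such that every $\mathbb X_i$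 satisfies VC$^\sharp$. *)

theory Defs
  imports Main
begin

unbundle cardinal_syntax

datatype fm = Le nat nat | Eq nat nat | Neg fm | Conj fm fm | Exi nat fm

primrec fv :: "fm \<Rightarrow> nat set" where
  "fv (Le m n) = {m, n}"
| "fv (Eq m n) = {m, n}"
| "fv (Neg \<phi>) = fv \<phi>"
| "fv (Conj \<phi> \<psi>) = fv \<phi> \<union> fv \<psi>"
| "fv (Exi n \<phi>) = fv \<phi> - {n}"

definition sentence :: "fm \<Rightarrow> bool" where
  "sentence \<phi> \<longleftrightarrow> fv \<phi> = {}"

type_synonym 'a struct = "'a set \<times> ('a \<times> 'a) set"

definition is_struct :: "'a struct \<Rightarrow> bool" where
  "is_struct M \<longleftrightarrow> fst M \<noteq> {} \<and> snd M \<subseteq> fst M \<times> fst M"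

primrec sat :: "'a struct \<Rightarrow> (nat \<Rightarrow> 'a) \<Rightarrow> fm \<Rightarrow> bool" where
  "sat M s (Le m n) \<longleftrightarrow> (s m, s n) \<in> snd M"
| "sat M s (Eq m n) \<longleftrightarrow> s m = s n"
| "sat M s (Neg \<phi>) \<longleftrightarrow> \<not> sat M s \<phi>"
| "sat M s (Conj \<phi> \<psi>) \<longleftrightarrow> sat M s \<phi> \<and> sat M s \<psi>"
| "sat M s (Exi n \<phi>) \<longleftrightarrow> (\<exists>a \<in> fst M. sat M (s(n := a)) \<phi>)"

definition holds :: "'a struct \<Rightarrow> fm \<Rightarrow> bool" where
  "holds M \<phi> \<longleftrightarrow> (\<forall>s. range s \<subseteq> fst M \<longrightarrow> sat M s \<phi>)"

definition models :: "fm set \<Rightarrow> 'a struct set" where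
  "models T = {M. is_struct M \<and> (\<forall>\<phi>\<in>T. holds M \<phi>)}"

definition Th :: "'a struct \<Rightarrow> fm set" where
  "Th M = {\<phi>. sentence \<phi> \<and> holds M \<phi>}"

text \<open>
  Up to isomorphism, the structures over \<^typ>\<open>nat\<close> are exactly the structures that are finite or
  countably infinite. The language is countable, so by the downward Loewenheim-Skolem theorem they
  suffice to determine satisfiability and logical consequence.
\<close>

definition entails :: "fm set \<Rightarrow> fm \<Rightarrow> bool" where
  "entails T \<phi> \<longleftrightarrow> (\<forall>M \<in> (models T :: nat struct set). holds M \<phi>)"

definition complete_theory :: "fm set \<Rightarrow> bool" where
  "complete_theory T \<longleftrightarrow>
     (\<forall>\<phi>\<in>T. sentence \<phi>) \<and>
     (models T :: nat struct set) \<noteq> {} \<and>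
     (\<forall>\<phi>. sentence \<phi> \<longrightarrow> entails T \<phi> \<or> entails T (Neg \<phi>))"

definition is_po :: "'a struct \<Rightarrow> bool" where
  "is_po M \<longleftrightarrow> is_struct M \<and> partial_order_on (fst M) (snd M)"

definition complete_po_theory :: "fm set \<Rightarrow> bool" where
  "complete_po_theory T \<longleftrightarrow>
     complete_theory T \<and> (\<forall>M \<in> (models T :: nat struct set). is_po M)"

definition isomorphic :: "'a struct \<Rightarrow> 'b struct \<Rightarrow> bool" where
  "isomorphic M N \<longleftrightarrow>
     (\<exists>f. bij_betw f (fst M) (fst N) \<and>
          (\<forall>x \<in> fst M. \<forall>y \<in> fst M. (x, y) \<in> snd M \<longleftrightarrow> (f x, f y) \<in> snd N))"

definition num_countable_models :: "fm set \<Rightarrow> nat struct set rel" where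
  "num_countable_models T =
     |models T // {(M, N). M \<in> models T \<and> N \<in> models T \<and> isomorphic M N}|"

definition VC_sharp_theory :: "fm set \<Rightarrow> bool" where
  "VC_sharp_theory T \<longleftrightarrow>
     num_countable_models T =o cone \<or> num_countable_models T =o ctwo ^c natLeq"

text \<open>The first disjunct is the convention that a finite partial order \<open>M\<close> has \<open>I(M) = 1\<close>.\<close>

definition VC_sharp :: "'a struct \<Rightarrow> bool" where
  "VC_sharp M \<longleftrightarrow> finite (fst M) \<or> VC_sharp_theory (Th M)"

definition induced :: "'a struct \<Rightarrow> 'a set \<Rightarrow> 'a struct" where
  "induced M B = (B, snd M \<inter> B \<times> B)"

definition lex_sum :: "'i struct \<Rightarrow> ('i \<Rightarrow> 'a struct) \<Rightarrow> 'a struct" where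
  "lex_sum J X =
     (\<Union>i \<in> fst J. fst (X i),
      {(x, y). (\<exists>i \<in> fst J. x \<in> fst (X i) \<and> y \<in> fst (X i) \<and> (x, y) \<in> snd (X i)) \<or>
               (\<exists>i \<in> fst J. \<exists>j \<in> fst J.
                  x \<in> fst (X i) \<and> y \<in> fst (X j) \<and> (i, j) \<in> snd J \<and> i \<noteq> j)})"

definition has_largest :: "'a struct \<Rightarrow> bool" where
  "has_largest M \<longleftrightarrow> (\<exists>m \<in> fst M. \<forall>x \<in> fst M. (x, m) \<in> snd M)"

definition FLD1_decomposition :: "'a struct \<Rightarrow> 'i struct \<Rightarrow> ('i \<Rightarrow> 'a set) \<Rightarrow> bool" where
  "FLD1_decomposition M J X \<longleftrightarrow>
     is_po J \<and> finite (fst J) \<and>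
     (\<forall>i \<in> fst J. X i \<noteq> {}) \<and>
     (\<forall>i \<in> fst J. \<forall>j \<in> fst J. i \<noteq> j \<longrightarrow> X i \<inter> X j = {}) \<and>
     (\<Union>i \<in> fst J. X i) = fst M \<and>
     M = lex_sum J (\<lambda>i. induced M (X i)) \<and>
     (\<forall>i \<in> fst J. has_largest (induced M (X i)))"

text \<open>Every finite index order is isomorphic to one whose domain is a set of natural numbers.\<close>

definition FLD1 :: "'a struct \<Rightarrow> bool" where
  "FLD1 M \<longleftrightarrow> is_po M \<and> (\<exists>(J :: nat struct) X. FLD1_decomposition M J X)"

text \<open>
  HOL cannot quantify existentially over types, so the type in which the required model lives is
  a parameter. A theorem assuming \<open>FLD1_theory TYPE('a) T\<close> for a type variable \<open>'a\<close> thus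
  covers models over every type; likewise for \<open>has_VC_sharp_decomposition\<close>.
\<close>

definition FLD1_theory :: "'a itself \<Rightarrow> fm set \<Rightarrow> bool" where
  "FLD1_theory (ty :: 'a itself) T \<longleftrightarrow>
     complete_po_theory T \<and> (\<exists>M \<in> (models T :: 'a struct set). FLD1 M)"

definition VC_sharp_decomposition :: "'a struct \<Rightarrow> 'i struct \<Rightarrow> ('i \<Rightarrow> 'a set) \<Rightarrow> bool" where
  "VC_sharp_decomposition M J X \<longleftrightarrow>
     FLD1_decomposition M J X \<and> (\<forall>i \<in> fst J. VC_sharp (induced M (X i)))"

definition has_VC_sharp_decomposition :: "'a itself \<Rightarrow> fm set \<Rightarrow> bool" where
  "has_VC_sharp_decomposition (ty :: 'a itself) T \<longleftrightarrow>
     (\<exists>M \<in> (models T :: 'a struct set). \<exists>(J :: nat struct) X. VC_sharp_decomposition M J X)"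

end

theory Submission
  imports Defs "HOL-Library.Countable_Set"
begin

text \<open>
  Let \<open>M\<close> be the lexicographic sum of structures \<open>A i\<close>, each satisfying VC-sharp. By a
  Feferman-Vaught argument the truth of a formula in a sum is determined by the truth of finitely
  many formulas in the summands.

  If every \<open>A i\<close> is finite or countably categorical, then by the Ryll-Nardzewski theorem it
  realizes finitely many \<open>n\<close>-types for each \<open>n\<close>. Hence so does \<open>M\<close>, and back-and-forth shows
  that any two countable models of its theory are isomorphic.

  If the theory of some \<open>A i\<close> has continuum many countable models \<open>N\<close>, replace \<open>A i\<close> by \<open>N\<close> and
  the other summands by countable elementarily equivalent structures. The resulting sums are
  models of the theory of \<open>M\<close>. The summands are definable from their largest elements, of which a
  countable structure offers only countably many choices, so at most countably many isomorphism
  types of \<open>N\<close> give isomorphic sums.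

  Countable models, in particular those omitting a non-isolated type, are obtained by Henkin's
  construction from a generic sequence of formulas satisfiable in a given structure; this makes a
  proof calculus unnecessary.
\<close>

section \<open>Renaming of variables and elementary equivalence\<close>

instance fm :: countable
  by countable_datatype

lemma finite_fv [simp]: "finite (fv \<phi>)"
  by (induction \<phi>) auto

lemma sat_cong: "(\<And>x. x \<in> fv \<phi> \<Longrightarrow> s x = s' x) \<Longrightarrow> sat M s \<phi> = sat M s' \<phi>"
proof (induction \<phi> arbitrary: s s')
  case (Exi n \<phi>)
  have "sat M (s(n := a)) \<phi> = sat M (s'(n := a)) \<phi>" for a
    by (rule Exi.IH) (use Exi.prems in auto)
  then show ?case by simp
next
  case (Conj \<phi> \<psi>)
  have "sat M s \<phi> = sat M s' \<phi>" by (rule Conj.IH) (use Conj.prems in auto)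
  moreover have "sat M s \<psi> = sat M s' \<psi>" by (rule Conj.IH) (use Conj.prems in auto)
  ultimately show ?case by simp
next
  case (Neg \<phi>)
  have "sat M s \<phi> = sat M s' \<phi>" by (rule Neg.IH) (use Neg.prems in auto)
  then show ?case by simp
qed auto

definition fresh :: "nat set \<Rightarrow> nat" where
  "fresh V = Suc (Max (insert 0 V))"

lemma fresh_notin: "finite V \<Longrightarrow> fresh V \<notin> V"
  unfolding fresh_def by (metis Max_ge finite.insertI insertI2 not_less_eq_eq order_refl)

primrec ren :: "fm \<Rightarrow> (nat \<Rightarrow> nat) \<Rightarrow> fm" where
  "ren (Le m n) t = Le (t m) (t n)"
| "ren (Eq m n) t = Eq (t m) (t n)"
| "ren (Neg \<phi>) t = Neg (ren \<phi> t)"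
| "ren (Conj \<phi> \<psi>) t = Conj (ren \<phi> t) (ren \<psi> t)"
| "ren (Exi n \<phi>) t =
     (let m = fresh (t ` fv \<phi>) in Exi m (ren \<phi> (t(n := m))))"

lemma sat_ren: "sat M s (ren \<phi> t) = sat M (s \<circ> t) \<phi>"
proof (induction \<phi> arbitrary: s t)
  case (Exi n \<phi>)
  define m where "m = fresh (t ` fv \<phi>)"
  have m: "m \<notin> t ` fv \<phi>" unfolding m_def by (rule fresh_notin) simp
  have "sat M (s(m := a) \<circ> t(n := m)) \<phi> = sat M ((s \<circ> t)(n := a)) \<phi>" for a
    by (rule sat_cong) (use m in auto)
  then show ?case by (simp only: ren.simps Let_def sat.simps Exi.IH flip: m_def)
qed auto

lemma fv_ren: "fv (ren \<phi> t) \<subseteq> t ` fv \<phi>"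
proof (induction \<phi> arbitrary: t)
  case (Exi n \<phi>)
  define m where "m = fresh (t ` fv \<phi>)"
  have "fv (ren \<phi> (t(n := m))) \<subseteq> (t(n := m)) ` fv \<phi>" by (rule Exi.IH)
  then show ?case by (auto simp: Let_def simp flip: m_def)
next
  case (Conj \<phi> \<psi>)
  show ?case using Conj.IH[of t] by (simp add: image_Un le_supI1 le_supI2)
qed auto

section \<open>Finite conjunctions and blocks of existential quantifiers\<close>

text \<open>The empty conjunction. It is true in every structure because domains are
  nonempty.\<close>

definition TT :: fm where "TT = Exi 0 (Eq 0 0)"

lemma fv_TT [simp]: "fv TT = {}"
  by (simp add: TT_def)

lemma sat_TT [simp]: "is_struct M \<Longrightarrow> sat M s TT"
  by (auto simp: TT_def is_struct_def)

definition big_conj :: "fm set \<Rightarrow> fm" where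
  "big_conj F = foldr Conj (SOME l. set l = F) TT"

lemma
  assumes "finite F"
  shows fv_big_conj: "fv (big_conj F) = (\<Union>\<phi>\<in>F. fv \<phi>)"
    and sat_big_conj: "is_struct M \<Longrightarrow> sat M s (big_conj F) \<longleftrightarrow> (\<forall>\<phi>\<in>F. sat M s \<phi>)"
proof -
  define l where "l = (SOME l. set l = F)"
  have l: "set l = F"
    unfolding l_def using finite_list[OF assms] by (rule someI_ex)
  have "fv (foldr Conj l TT) = (\<Union>\<phi>\<in>set l. fv \<phi>)" by (induction l) auto
  then show "fv (big_conj F) = (\<Union>\<phi>\<in>F. fv \<phi>)"
    using l unfolding big_conj_def l_def by simp
  assume M: "is_struct M"
  have "sat M s (foldr Conj l TT) \<longleftrightarrow> (\<forall>\<phi>\<in>set l. sat M s \<phi>)" by (induction l) (auto simp: M)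
  then show "sat M s (big_conj F) \<longleftrightarrow> (\<forall>\<phi>\<in>F. sat M s \<phi>)"
    using l unfolding big_conj_def l_def by simp
qed

lemma fv_foldr_Exi: "fv (foldr Exi l \<phi>) = fv \<phi> - set l"
  by (induction l) auto

lemma sat_foldr_Exi:
  "sat M s (foldr Exi l \<phi>) \<longleftrightarrow>
     (\<exists>s'. (\<forall>x. x \<notin> set l \<longrightarrow> s' x = s x) \<and> (\<forall>x\<in>set l. s' x \<in> fst M) \<and> sat M s' \<phi>)"
proof (induction l arbitrary: s)
  case Nil
  show ?case by (simp flip: fun_eq_iff)
next
  case (Cons y l)
  show ?case
  proof
    assume "sat M s (foldr Exi (y # l) \<phi>)"
    then obtain a s' where "a \<in> fst M" "\<forall>x. x \<notin> set l \<longrightarrow> s' x = (s(y := a)) x"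
      "\<forall>x\<in>set l. s' x \<in> fst M" "sat M s' \<phi>" by (auto simp: Cons.IH)
    then show "\<exists>s'. (\<forall>x. x \<notin> set (y # l) \<longrightarrow> s' x = s x) \<and>
        (\<forall>x\<in>set (y # l). s' x \<in> fst M) \<and> sat M s' \<phi>"
      by (intro exI[of _ s']) (auto split: if_splits)
  next
    assume "\<exists>s'. (\<forall>x. x \<notin> set (y # l) \<longrightarrow> s' x = s x) \<and>
        (\<forall>x\<in>set (y # l). s' x \<in> fst M) \<and> sat M s' \<phi>"
    then obtain s' where "\<forall>x. x \<notin> set (y # l) \<longrightarrow> s' x = s x"
        "\<forall>x\<in>set (y # l). s' x \<in> fst M" "sat M s' \<phi>" by blast
    then have "s' y \<in> fst M \<and> sat M (s(y := s' y)) (foldr Exi l \<phi>)"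
      unfolding Cons.IH by (auto intro!: exI[of _ s'])
    then show "sat M s (foldr Exi (y # l) \<phi>)" by auto
  qed
qed

section \<open>Implication in a structure and elementary equivalence\<close>

definition fm_implies :: "'a struct \<Rightarrow> fm \<Rightarrow> fm \<Rightarrow> bool" where
  "fm_implies M \<phi> \<psi> \<longleftrightarrow> (\<forall>s. range s \<subseteq> fst M \<longrightarrow> sat M s \<phi> \<longrightarrow> sat M s \<psi>)"

lemma fm_implies_iff_holds: "fm_implies M \<phi> \<psi> \<longleftrightarrow> holds M (Neg (Conj \<phi> (Neg \<psi>)))"
  by (auto simp: fm_implies_def holds_def)

definition elem_equiv :: "'a struct \<Rightarrow> 'b struct \<Rightarrow> bool" where
  "elem_equiv M N \<longleftrightarrow> (\<forall>\<phi>. sentence \<phi> \<longrightarrow> holds M \<phi> = holds N \<phi>)"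

lemma elem_equiv_sym: "elem_equiv M N \<Longrightarrow> elem_equiv N M"
  and elem_equiv_trans: "elem_equiv M N \<Longrightarrow> elem_equiv N K \<Longrightarrow> elem_equiv M K"
  by (auto simp: elem_equiv_def)

lemma ex_valuation: "is_struct M \<Longrightarrow> \<exists>s :: nat \<Rightarrow> 'a. range s \<subseteq> fst (M :: 'a struct)"
  unfolding is_struct_def by (metis equals0I image_subset_iff)

lemma holds_sentence:
  assumes "sentence \<phi>" "range s \<subseteq> fst M"
  shows "holds M \<phi> = sat M s \<phi>"
proof -
  have "sat M s' \<phi> = sat M s \<phi>" for s'
    by (rule sat_cong) (use assms in \<open>auto simp: sentence_def\<close>)
  then show ?thesis using assms(2) by (auto simp: holds_def)
qed

text \<open>Since \<open>holds\<close> quantifies over all valuations, an open formula can be traded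
  for its universal closure. Thus \<open>elem_equiv\<close>, which speaks of sentences, also
  controls open formulas.\<close>

lemma holds_universal_closure:
  fixes K :: "'a struct"
  assumes l: "set l = fv \<phi>" and K: "is_struct K"
  shows "holds K (Neg (foldr Exi l (Neg \<phi>))) = holds K \<phi>"
proof -
  define \<psi> where "\<psi> = Neg (foldr Exi l (Neg \<phi>))"
  have \<psi>: "sentence \<psi>" by (simp add: \<psi>_def sentence_def fv_foldr_Exi l)
  obtain s :: "nat \<Rightarrow> 'a" where s: "range s \<subseteq> fst K" using ex_valuation[OF K] by blast
  have "sat K s \<psi> \<longleftrightarrow> holds K \<phi>"
  proof
    assume "holds K \<phi>"
    have "sat K s' \<phi>" if "\<forall>x. x \<notin> fv \<phi> \<longrightarrow> s' x = s x" "\<forall>x\<in>fv \<phi>. s' x \<in> fst K" for s'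
    proof -
      have "range s' \<subseteq> fst K" using s that by (metis image_subset_iff)
      then show "sat K s' \<phi>" using \<open>holds K \<phi>\<close> by (auto simp: holds_def)
    qed
    then show "sat K s \<psi>" unfolding \<psi>_def by (auto simp: sat_foldr_Exi l)
  next
    assume a: "sat K s \<psi>"
    show "holds K \<phi>" unfolding holds_def
    proof (intro allI impI)
      fix s' :: "nat \<Rightarrow> 'a" assume s': "range s' \<subseteq> fst K"
      \<comment> \<open>The quantifier block ranges only over valuations that agree with
        \<open>s\<close> outside \<open>fv \<phi>\<close>, so \<open>s'\<close> is first altered
        there.\<close>
      define r where "r = (\<lambda>x. if x \<in> fv \<phi> then s' x else s x)"
      have "\<forall>x. x \<notin> fv \<phi> \<longrightarrow> r x = s x" "\<forall>x\<in>fv \<phi>. r x \<in> fst K"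
        using s' by (auto simp: r_def)
      then have "sat K r \<phi>" using a unfolding \<psi>_def by (auto simp: sat_foldr_Exi l)
      moreover have "sat K r \<phi> = sat K s' \<phi>" by (rule sat_cong) (simp add: r_def)
      ultimately show "sat K s' \<phi>" by simp
    qed
  qed
  then show ?thesis using holds_sentence[OF \<psi> s] by (simp add: \<psi>_def)
qed

lemma elem_equiv_holds:
  assumes "is_struct M" "is_struct N" "elem_equiv M N"
  shows "holds M \<phi> = holds N \<phi>"
proof -
  obtain l where l: "set l = fv \<phi>" using finite_list[of "fv \<phi>"] by auto
  have "sentence (Neg (foldr Exi l (Neg \<phi>)))" by (simp add: sentence_def fv_foldr_Exi l)
  then show ?thesis
    using assms(3) holds_universal_closure[OF l assms(1)] holds_universal_closure[OF l assms(2)]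
    by (simp add: elem_equiv_def)
qed

section \<open>Models from generic sequences of formulas\<close>

text \<open>A term model in which the variables act as Henkin constants. Finite satisfiability in
  the single structure \<open>M\<close> replaces deductive consistency.\<close>

lemma henkin_model:
  fixes M :: "'a struct"
  assumes M: "is_struct M"
    and fin: "\<And>G. finite G \<Longrightarrow> G \<subseteq> \<Delta> \<Longrightarrow> \<exists>s. range s \<subseteq> fst M \<and> (\<forall>\<phi>\<in>G. sat M s \<phi>)"
    and dec: "\<And>\<phi>. \<phi> \<in> \<Delta> \<or> Neg \<phi> \<in> \<Delta>"
    and wit: "\<And>n \<phi>. Exi n \<phi> \<in> \<Delta> \<Longrightarrow> \<exists>m. ren \<phi> (id(n := m)) \<in> \<Delta>"
  shows "\<exists>(N :: nat struct) v. is_struct N \<and> range v = fst N \<and> (\<forall>\<phi>. sat N v \<phi> \<longleftrightarrow> \<phi> \<in> \<Delta>)"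
proof -
  \<comment> \<open>\<Delta> is closed under consequence in \<open>M\<close>: otherwise
    \<open>Neg \<psi>\<close> is in \<Delta> and, together with \<open>G\<close>, is a finite
    unsatisfiable part.\<close>
  have cl: "\<psi> \<in> \<Delta>" if G: "finite G" "G \<subseteq> \<Delta>"
    and G_imp: "\<And>s. range s \<subseteq> fst M \<Longrightarrow> (\<forall>\<phi>\<in>G. sat M s \<phi>) \<Longrightarrow> sat M s \<psi>" for G \<psi>
  proof (rule ccontr)
    assume "\<psi> \<notin> \<Delta>"
    then have "insert (Neg \<psi>) G \<subseteq> \<Delta>" using dec[of \<psi>] G(2) by auto
    then obtain s where "range s \<subseteq> fst M" "\<forall>\<phi>\<in>insert (Neg \<psi>) G. sat M s \<phi>"
      using fin[of "insert (Neg \<psi>) G"] G(1) by auto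
    then show False using G_imp[of s] by auto
  qed
  have cl1: "\<psi> \<in> \<Delta>" if "\<phi> \<in> \<Delta>" "fm_implies M \<phi> \<psi>" for \<phi> \<psi>
    by (rule cl[of "{\<phi>}"]) (use that in \<open>auto simp: fm_implies_def\<close>)
  have neg: "Neg \<phi> \<in> \<Delta> \<longleftrightarrow> \<phi> \<notin> \<Delta>" for \<phi>
    using dec[of \<phi>] fin[of "{\<phi>, Neg \<phi>}"] by auto
  have conj: "Conj \<phi> \<psi> \<in> \<Delta> \<longleftrightarrow> \<phi> \<in> \<Delta> \<and> \<psi> \<in> \<Delta>" for \<phi> \<psi>
    by (auto intro: cl1[of "Conj \<phi> \<psi>"] cl[of "{\<phi>, \<psi>}"] simp: fm_implies_def)
  have eq_refl: "Eq k k \<in> \<Delta>" for k by (rule cl[of "{}"]) auto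
  have eq_sym: "Eq j k \<in> \<Delta>" if "Eq k j \<in> \<Delta>" for j k
    by (rule cl1[OF that]) (auto simp: fm_implies_def)
  have eq_trans: "Eq i k \<in> \<Delta>" if "Eq i j \<in> \<Delta>" "Eq j k \<in> \<Delta>" for i j k
    by (rule cl[of "{Eq i j, Eq j k}"]) (use that in auto)
  have le_cong: "Le i' j' \<in> \<Delta>" if "Le i j \<in> \<Delta>" "Eq i i' \<in> \<Delta>" "Eq j j' \<in> \<Delta>" for i j i' j'
    by (rule cl[of "{Le i j, Eq i i', Eq j j'}"]) (use that in auto)
  \<comment> \<open>Instead of a quotient by provable equality, each class is represented by its
    least variable, so the domain is a set of naturals.\<close>
  define v where "v k = (LEAST j. Eq k j \<in> \<Delta>)" for k
  have v: "Eq k (v k) \<in> \<Delta>" for k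
    unfolding v_def by (rule LeastI) (rule eq_refl)
  have v_eq: "v k = v j \<longleftrightarrow> Eq k j \<in> \<Delta>" for j k
  proof
    assume "v k = v j" then show "Eq k j \<in> \<Delta>" using v[of k] v[of j] eq_sym eq_trans by metis
  next
    assume "Eq k j \<in> \<Delta>"
    then have "Eq k i \<in> \<Delta> \<longleftrightarrow> Eq j i \<in> \<Delta>" for i using eq_sym eq_trans by metis
    then show "v k = v j" by (simp add: v_def)
  qed
  define N :: "nat struct"
    where "N = (range v, {(x, y). x \<in> range v \<and> y \<in> range v \<and> Le x y \<in> \<Delta>})"
  have N: "is_struct N" by (auto simp: N_def is_struct_def)
  have le: "(v k, v j) \<in> snd N \<longleftrightarrow> Le k j \<in> \<Delta>" for k j
    using le_cong v eq_sym by (auto simp: N_def)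
  \<comment> \<open>Generalizing over \<open>t\<close> is what lets the induction pass through the
    renamed bodies that \<open>wit\<close> provides; \<open>t = id\<close> is the case wanted in the
    end.\<close>
  have truth: "sat N (v \<circ> t) \<phi> \<longleftrightarrow> ren \<phi> t \<in> \<Delta>" for \<phi> t
  proof (induction \<phi> arbitrary: t)
    case (Exi n \<phi>)
    have upd: "(v \<circ> t)(n := v k) = v \<circ> t(n := k)" for k by (auto simp: fun_eq_iff)
    have "sat N (v \<circ> t) (Exi n \<phi>) \<longleftrightarrow> (\<exists>k. sat N ((v \<circ> t)(n := v k)) \<phi>)"
      by (auto simp: N_def)
    also have "\<dots> \<longleftrightarrow> (\<exists>k. ren \<phi> (t(n := k)) \<in> \<Delta>)" unfolding upd Exi.IH ..
    also have "\<dots> \<longleftrightarrow> ren (Exi n \<phi>) t \<in> \<Delta>"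
    proof
      assume "\<exists>k. ren \<phi> (t(n := k)) \<in> \<Delta>"
      then obtain k where k: "ren \<phi> (t(n := k)) \<in> \<Delta>" ..
      show "ren (Exi n \<phi>) t \<in> \<Delta>"
      proof (rule cl1[OF k], unfold fm_implies_def sat_ren, intro allI impI)
        fix s :: "nat \<Rightarrow> 'a" assume s: "range s \<subseteq> fst M" "sat M (s \<circ> t(n := k)) \<phi>"
        have "s \<circ> t(n := k) = (s \<circ> t)(n := s k)" by (auto simp: fun_eq_iff)
        then show "sat M (s \<circ> t) (Exi n \<phi>)" using s by auto
      qed
    next
      define m where "m = fresh (t ` fv \<phi>)"
      have m: "m \<notin> t ` fv \<phi>" unfolding m_def by (rule fresh_notin) simp
      assume "ren (Exi n \<phi>) t \<in> \<Delta>"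
      then have "Exi m (ren \<phi> (t(n := m))) \<in> \<Delta>" by (simp add: Let_def m_def)
      then obtain k where k: "ren (ren \<phi> (t(n := m))) (id(m := k)) \<in> \<Delta>" using wit by blast
      \<comment> \<open>Renaming in two stages, first \<open>n\<close> to the fresh \<open>m\<close>
        and then \<open>m\<close> to \<open>k\<close>, agrees on \<open>fv \<phi>\<close> with
        renaming \<open>n\<close> to \<open>k\<close> directly, as \<open>m\<close> is not an image
        under \<open>t\<close>.\<close>
      have "ren \<phi> (t(n := k)) \<in> \<Delta>"
      proof (rule cl1[OF k], unfold fm_implies_def sat_ren, intro allI impI)
        fix s :: "nat \<Rightarrow> 'a" assume s: "sat M ((s \<circ> id(m := k)) \<circ> t(n := m)) \<phi>"
        have "sat M ((s \<circ> id(m := k)) \<circ> t(n := m)) \<phi> = sat M (s \<circ> t(n := k)) \<phi>"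
          by (rule sat_cong) (use m in auto)
        with s show "sat M (s \<circ> t(n := k)) \<phi>" by simp
      qed
      then show "\<exists>k. ren \<phi> (t(n := k)) \<in> \<Delta>" ..
    qed
    finally show ?case .
  qed (auto simp: le v_eq neg conj)
  have "sat N v \<phi> \<longleftrightarrow> \<phi> \<in> \<Delta>" for \<phi>
  proof -
    have "fm_implies M (ren \<phi> id) \<phi>" "fm_implies M \<phi> (ren \<phi> id)" by (auto simp: fm_implies_def sat_ren)
    then have "ren \<phi> id \<in> \<Delta> \<longleftrightarrow> \<phi> \<in> \<Delta>" using cl1 by blast
    then show ?thesis using truth[of id \<phi>] by simp
  qed
  moreover have "range v = fst N" by (simp add: N_def)
  ultimately show ?thesis using N by blast
qed

section \<open>Consistency relative to a structure and generic sequences\<close>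

text \<open>By compactness this amounts to consistency of \<phi> with \<Gamma> and the theory of
  \<open>M\<close>; \<Gamma> as a whole need not be realized in \<open>M\<close>.\<close>

definition consistent :: "'a struct \<Rightarrow> fm set \<Rightarrow> fm \<Rightarrow> bool" where
  "consistent M \<Gamma> \<phi> \<longleftrightarrow>
     (\<forall>G. finite G \<and> G \<subseteq> \<Gamma> \<longrightarrow>
        (\<exists>s. range s \<subseteq> fst M \<and> (\<forall>\<gamma>\<in>G. sat M s \<gamma>) \<and> sat M s \<phi>))"

lemma consistent_sat: "consistent M \<Gamma> \<phi> \<Longrightarrow> \<exists>s. range s \<subseteq> fst M \<and> sat M s \<phi>"
  unfolding consistent_def by (metis empty_subsetI finite.emptyI)

lemma consistentD:
  assumes "consistent M \<Gamma> \<phi>" "finite G" "G \<subseteq> \<Gamma>"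
  obtains s where "range s \<subseteq> fst M" "\<And>\<gamma>. \<gamma> \<in> G \<Longrightarrow> sat M s \<gamma>" "sat M s \<phi>"
  using assms unfolding consistent_def by (elim allE[of _ G]) auto

lemma inconsistentD:
  assumes "\<not> consistent M \<Gamma> \<phi>"
  obtains G where "finite G" "G \<subseteq> \<Gamma>"
    "\<And>s. range s \<subseteq> fst M \<Longrightarrow> (\<And>\<gamma>. \<gamma> \<in> G \<Longrightarrow> sat M s \<gamma>) \<Longrightarrow> \<not> sat M s \<phi>"
proof -
  obtain G where "finite G" "G \<subseteq> \<Gamma>"
    and "\<not> (\<exists>s. range s \<subseteq> fst M \<and> (\<forall>\<gamma>\<in>G. sat M s \<gamma>) \<and> sat M s \<phi>)"
    using assms unfolding consistent_def by blast
  then show thesis by (intro that[of G]) blast+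
qed

text \<open>If both extensions failed, the union of the two finite parts refuting them would refute
  \<phi> itself.\<close>

lemma consistent_decide:
  assumes "consistent M \<Gamma> \<phi>"
  shows "consistent M \<Gamma> (Conj \<phi> \<psi>) \<or> consistent M \<Gamma> (Conj \<phi> (Neg \<psi>))"
proof (rule ccontr)
  assume neg: "\<not> ?thesis"
  obtain G1 where G1: "finite G1" "G1 \<subseteq> \<Gamma>"
    "\<And>s. range s \<subseteq> fst M \<Longrightarrow> (\<And>\<gamma>. \<gamma> \<in> G1 \<Longrightarrow> sat M s \<gamma>) \<Longrightarrow> \<not> sat M s (Conj \<phi> \<psi>)"
    using neg by (auto elim: inconsistentD)
  obtain G2 where G2: "finite G2" "G2 \<subseteq> \<Gamma>"
    "\<And>s. range s \<subseteq> fst M \<Longrightarrow> (\<And>\<gamma>. \<gamma> \<in> G2 \<Longrightarrow> sat M s \<gamma>) \<Longrightarrow> \<not> sat M s (Conj \<phi> (Neg \<psi>))"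
    using neg by (auto elim: inconsistentD)
  obtain s where "range s \<subseteq> fst M" "\<And>\<gamma>. \<gamma> \<in> G1 \<union> G2 \<Longrightarrow> sat M s \<gamma>" "sat M s \<phi>"
    by (rule consistentD[OF assms, of "G1 \<union> G2"]) (use G1 G2 in auto)
  then show False using G1(3)[of s] G2(3)[of s] by auto
qed

lemma consistent_witness:
  assumes "consistent M \<Gamma> (Conj \<phi> (Exi n \<chi>))" and \<Gamma>: "\<And>\<gamma>. \<gamma> \<in> \<Gamma> \<Longrightarrow> fv \<gamma> \<subseteq> {..<N}"
  shows "\<exists>m. consistent M \<Gamma> (Conj \<phi> (ren \<chi> (id(n := m))))"
proof -
  define m where "m = fresh ({..<N} \<union> fv \<phi> \<union> fv \<chi>)"
  have m: "m \<notin> {..<N} \<union> fv \<phi> \<union> fv \<chi>" unfolding m_def by (rule fresh_notin) simp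
  have "\<exists>s. range s \<subseteq> fst M \<and> (\<forall>\<gamma>\<in>G. sat M s \<gamma>) \<and> sat M s (Conj \<phi> (ren \<chi> (id(n := m))))"
    if G: "finite G" "G \<subseteq> \<Gamma>" for G
  proof -
    obtain s a where s: "range s \<subseteq> fst M" "\<forall>\<gamma>\<in>G. sat M s \<gamma>" "sat M s \<phi>"
      "a \<in> fst M" "sat M (s(n := a)) \<chi>"
      by (rule consistentD[OF assms(1) G]) auto
    have "sat M (s(m := a)) \<gamma>" if "\<gamma> \<in> G" for \<gamma>
    proof -
      have "sat M (s(m := a)) \<gamma> = sat M s \<gamma>"
        by (rule sat_cong) (use m \<Gamma>[of \<gamma>] that G in auto)
      then show ?thesis using s(2) that by simp
    qed
    moreover have "sat M (s(m := a)) \<phi> = sat M s \<phi>" by (rule sat_cong) (use m in auto)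
    moreover have "sat M (s(m := a) \<circ> id(n := m)) \<chi> = sat M (s(n := a)) \<chi>"
      by (rule sat_cong) (use m in auto)
    moreover have "range (s(m := a)) \<subseteq> fst M" using s by auto
    ultimately show ?thesis using s by (intro exI[of _ "s(m := a)"]) (simp add: sat_ren)
  qed
  then show ?thesis unfolding consistent_def by blast
qed

text \<open>A sequence of ever stronger formulas decides every formula, adds witnesses and enters
  each dense family \<open>E k\<close>. The set \<Gamma> serves to realize a type, the families
  \<open>E k\<close> to omit one.\<close>

lemma generic_model:
  fixes M :: "'a struct"
  assumes M: "is_struct M" and \<Gamma>: "\<And>\<gamma>. \<gamma> \<in> \<Gamma> \<Longrightarrow> fv \<gamma> \<subseteq> {..<N}"
    and con: "consistent M \<Gamma> TT"
    and dense: "\<And>k \<phi>. consistent M \<Gamma> \<phi> \<Longrightarrow> \<exists>\<psi>\<in>E k. consistent M \<Gamma> (Conj \<phi> \<psi>)"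
  shows "\<exists>(N :: nat struct) v. is_struct N \<and> range v = fst N \<and> elem_equiv M N \<and>
    (\<forall>\<gamma>\<in>\<Gamma>. sat N v \<gamma>) \<and> (\<forall>k::nat. \<exists>\<psi>\<in>E k. sat N v \<psi>)"
proof -
  \<comment> \<open>The demands on step \<open>k\<close>: strengthen \<phi>, decide the
    \<open>k\<close>-th formula with a witness if it is an accepted existential one, and enter
    \<open>E k\<close>.\<close>
  define Q where "Q k \<phi> \<phi>' \<longleftrightarrow> fm_implies M \<phi>' \<phi> \<and>
      (fm_implies M \<phi>' (Neg (from_nat k)) \<or> fm_implies M \<phi>' (from_nat k) \<and>
         (\<forall>n \<chi>. from_nat k = Exi n \<chi> \<longrightarrow> (\<exists>m. fm_implies M \<phi>' (ren \<chi> (id(n := m)))))) \<and>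
      (\<exists>\<psi>\<in>E k. fm_implies M \<phi>' \<psi>)" for k \<phi> \<phi>'
  have step: "\<exists>\<phi>'. consistent M \<Gamma> \<phi>' \<and> Q k \<phi> \<phi>'" if c: "consistent M \<Gamma> \<phi>" for k \<phi>
  proof -
    obtain \<psi> where \<psi>: "\<psi> \<in> E k" "consistent M \<Gamma> (Conj \<phi> \<psi>)" using dense[OF c] by blast
    define \<theta> :: fm where "\<theta> = from_nat k"
    consider "consistent M \<Gamma> (Conj (Conj \<phi> \<psi>) (Neg \<theta>))"
      | "consistent M \<Gamma> (Conj (Conj \<phi> \<psi>) \<theta>)" "\<nexists>n \<chi>. \<theta> = Exi n \<chi>"
      | n \<chi> where "consistent M \<Gamma> (Conj (Conj \<phi> \<psi>) \<theta>)" "\<theta> = Exi n \<chi>"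
      using consistent_decide[OF \<psi>(2)] by blast
    then show ?thesis
    proof cases
      case 1
      then show ?thesis using \<psi>(1)
        by (intro exI[of _ "Conj (Conj \<phi> \<psi>) (Neg \<theta>)"])
          (auto simp: Q_def fm_implies_def simp flip: \<theta>_def)
    next
      case 2
      then show ?thesis using \<psi>(1)
        by (intro exI[of _ "Conj (Conj \<phi> \<psi>) \<theta>"])
          (auto simp: Q_def fm_implies_def simp flip: \<theta>_def)
    next
      case (3 n \<chi>)
      obtain m where m: "consistent M \<Gamma> (Conj (Conj \<phi> \<psi>) (ren \<chi> (id(n := m))))"
        using consistent_witness[OF _ \<Gamma>] 3 by blast
      \<comment> \<open>The witnessed instance implies the existential formula, so it can be added
        in its place.\<close>
      have "fm_implies M (Conj (Conj \<phi> \<psi>) (ren \<chi> (id(n := m)))) \<theta>"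
      proof (unfold fm_implies_def, intro allI impI)
        fix s :: "nat \<Rightarrow> 'a" 
        assume s: "range s \<subseteq> fst M" "sat M s (Conj (Conj \<phi> \<psi>) (ren \<chi> (id(n := m))))"
        have "s \<circ> id(n := m) = s(n := s m)" by (auto simp: fun_eq_iff)
        then show "sat M s \<theta>" using s by (auto simp: 3 sat_ren)
      qed
      with m show ?thesis using \<psi>(1) 3(2)
        by (intro exI[of _ "Conj (Conj \<phi> \<psi>) (ren \<chi> (id(n := m)))"])
          (auto simp: Q_def fm_implies_def simp flip: \<theta>_def)
    qed
  qed
  obtain c where c: "\<And>k. consistent M \<Gamma> (c k)" and Q: "\<And>k. Q k (c k) (c (Suc k))"
    using dependent_nat_choice[of "\<lambda>_ \<phi>. consistent M \<Gamma> \<phi>" Q] con step by metis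
  have mono: "fm_implies M (c j) (c i)" if "i \<le> j" for i j
    using that
  proof (induction j rule: dec_induct)
    case base then show ?case by (simp add: fm_implies_def)
  next
    case (step j) then show ?case using Q[of j] by (auto simp: Q_def fm_implies_def)
  qed
  define \<Delta> where "\<Delta> = {\<psi>. \<exists>k. fm_implies M (c k) \<psi>}"
  have bound: "\<exists>k. \<forall>\<psi>\<in>G. fm_implies M (c k) \<psi>" if "finite G" "G \<subseteq> \<Delta>" for G
    using that
  proof (induction G rule: finite_induct)
    case (insert g G)
    then obtain k k' where k: "\<forall>\<psi>\<in>G. fm_implies M (c k) \<psi>" "fm_implies M (c k') g"
      by (auto simp: \<Delta>_def)
    have "\<forall>\<psi>\<in>insert g G. fm_implies M (c (max k k')) \<psi>"
      using k mono[of k "max k k'"] mono[of k' "max k k'"] by (auto simp: fm_implies_def)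
    then show ?case ..
  qed auto
  have fin: "\<exists>s. range s \<subseteq> fst M \<and> (\<forall>\<phi>\<in>G. sat M s \<phi>)" if G: "finite G" "G \<subseteq> \<Delta>" for G
  proof -
    obtain k where "\<forall>\<psi>\<in>G. fm_implies M (c k) \<psi>" using bound[OF G] ..
    moreover obtain s where "range s \<subseteq> fst M" "sat M s (c k)"
      using consistent_sat[OF c] by blast
    ultimately show ?thesis by (auto simp: fm_implies_def)
  qed
  \<comment> \<open>Each formula is decided at the step given by its own code.\<close>
  have dec: "\<phi> \<in> \<Delta> \<or> Neg \<phi> \<in> \<Delta>" for \<phi>
    using Q[of "to_nat \<phi>"] by (auto simp: Q_def \<Delta>_def)
  have excl: "\<not> (\<phi> \<in> \<Delta> \<and> Neg \<phi> \<in> \<Delta>)" for \<phi> using fin[of "{\<phi>, Neg \<phi>}"] by auto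
  have wit: "\<exists>m. ren \<phi> (id(n := m)) \<in> \<Delta>" if "Exi n \<phi> \<in> \<Delta>" for n \<phi>
  proof -
    have "\<not> fm_implies M (c (Suc (to_nat (Exi n \<phi>)))) (Neg (Exi n \<phi>))"
      using excl[of "Exi n \<phi>"] that by (auto simp: \<Delta>_def)
    then show ?thesis using Q[of "to_nat (Exi n \<phi>)"] by (auto simp: Q_def \<Delta>_def)
  qed
  obtain N :: "nat struct" and v where N: "is_struct N" "range v = fst N"
    and truth: "\<And>\<phi>. sat N v \<phi> \<longleftrightarrow> \<phi> \<in> \<Delta>"
    using henkin_model[OF M fin dec wit] by blast
  have "sat N v \<gamma>" if "\<gamma> \<in> \<Gamma>" for \<gamma>
  proof (rule ccontr)
    assume "\<not> sat N v \<gamma>"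
    then obtain k where k: "fm_implies M (c k) (Neg \<gamma>)"
      \<comment> \<open>If \<gamma> were rejected, some stage would refute it, although every stage
        is consistent with \<Gamma>.\<close>
      using dec[of \<gamma>] unfolding truth by (auto simp: \<Delta>_def)
    obtain s where "range s \<subseteq> fst M" "sat M s \<gamma>" "sat M s (c k)"
      by (rule consistentD[OF c[of k], of "{\<gamma>}"]) (use \<open>\<gamma> \<in> \<Gamma>\<close> in auto)
    then show False using k by (auto simp: fm_implies_def)
  qed
  moreover have "\<exists>\<psi>\<in>E k. sat N v \<psi>" for k
    using Q[of k] unfolding truth by (auto simp: Q_def \<Delta>_def)
  moreover have "elem_equiv M N" unfolding elem_equiv_def
  proof (intro allI impI)
    fix \<phi> assume \<phi>: "sentence \<phi>"
    obtain s :: "nat \<Rightarrow> 'a" where s: "range s \<subseteq> fst M" using ex_valuation[OF M] by blast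
    have N': "holds N \<phi> \<longleftrightarrow> \<phi> \<in> \<Delta>" using holds_sentence[OF \<phi>, of v N] N truth by simp
    have n: "holds M (Neg \<phi>) \<longleftrightarrow> \<not> holds M \<phi>"
      using holds_sentence[OF _ s] \<phi> by (simp add: sentence_def)
    \<comment> \<open>A formula valid in \<open>M\<close> is implied there by every stage, so
      \<Delta> contains the theory of \<open>M\<close>.\<close>
    have "\<psi> \<in> \<Delta>" if "holds M \<psi>" for \<psi>
      using that by (auto simp: \<Delta>_def fm_implies_def holds_def)
    then show "holds M \<phi> = holds N \<phi>" using N' n excl[of \<phi>] by blast
  qed
  ultimately show ?thesis using N by blast
qed

lemma consistent_empty_iff: "consistent M {} \<phi> \<longleftrightarrow> (\<exists>s. range s \<subseteq> fst M \<and> sat M s \<phi>)"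
  by (auto simp: consistent_def)

text \<open>The downward Loewenheim-Skolem theorem, as the generic model for trivial \<Gamma> and
  trivial dense families.\<close>

lemma ex_countable_elem_equiv:
  fixes M :: "'a struct"
  assumes M: "is_struct M"
  shows "\<exists>N :: nat struct. is_struct N \<and> elem_equiv M N"
proof -
  have "\<exists>\<psi>\<in>{TT}. consistent M {} (Conj \<phi> \<psi>)" if "consistent M {} \<phi>" for \<phi>
    using that M by (auto simp: consistent_empty_iff)
  moreover have "consistent M {} TT"
    using M ex_valuation[OF M] by (auto simp: consistent_empty_iff)
  ultimately show ?thesis using generic_model[OF M, of "{}" 0 "\<lambda>_. {TT}"] by blast
qed

section \<open>Countably categorical structures\<close>

text \<open>Such a formula isolates an \<open>n\<close>-type of the theory of \<open>M\<close>, or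
  else is unsatisfiable in \<open>M\<close>.\<close>

definition complete_fm :: "'a struct \<Rightarrow> nat \<Rightarrow> fm \<Rightarrow> bool" where
  "complete_fm M n \<theta> \<longleftrightarrow> fv \<theta> \<subseteq> {..<n} \<and>
     (\<forall>\<pi>. fv \<pi> \<subseteq> {..<n} \<longrightarrow> fm_implies M \<theta> \<pi> \<or> fm_implies M \<theta> (Neg \<pi>))"

text \<open>The condition of the Ryll-Nardzewski theorem that there are finitely many
  \<open>n\<close>-types for each \<open>n\<close>. Stating it through isolating formulas makes it
  pass to elementarily equivalent structures.\<close>

definition ryll_nardzewski :: "'a struct \<Rightarrow> bool" where
  "ryll_nardzewski M \<longleftrightarrow> (\<forall>n. \<exists>\<Theta>. finite \<Theta> \<and> (\<forall>\<theta>\<in>\<Theta>. complete_fm M n \<theta>) \<and>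
     (\<forall>s. range s \<subseteq> fst M \<longrightarrow> (\<exists>\<theta>\<in>\<Theta>. sat M s \<theta>)))"

lemma isomorphic_sat:
  assumes f: "bij_betw f (fst M) (fst N)"
      "\<And>x y. x \<in> fst M \<Longrightarrow> y \<in> fst M \<Longrightarrow> (x, y) \<in> snd M \<longleftrightarrow> (f x, f y) \<in> snd N"
    and "range s \<subseteq> fst M"
  shows "sat M s \<phi> = sat N (f \<circ> s) \<phi>"
  using assms(3)
proof (induction \<phi> arbitrary: s)
  case (Eq m n)
  then have "s m \<in> fst M" "s n \<in> fst M" by auto
  then show ?case using inj_on_eq_iff[OF bij_betw_imp_inj_on[OF f(1)]] by simp
next
  case (Exi n \<phi>)
  have "sat N ((f \<circ> s)(n := f a)) \<phi> = sat M (s(n := a)) \<phi>" if "a \<in> fst M" for a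
  proof -
    have "(f \<circ> s)(n := f a) = f \<circ> s(n := a)" by (auto simp: fun_eq_iff)
    moreover have "range (s(n := a)) \<subseteq> fst M" using Exi.prems that by auto
    ultimately show ?thesis by (simp only: Exi.IH)
  qed
  moreover have "fst N = f ` fst M" using f(1) by (simp add: bij_betw_def)
  ultimately show ?case unfolding sat.simps by (simp only: bex_simps) blast
next
  case (Le m n)
  then show ?case using f(2) by (simp add: image_subset_iff)
qed simp_all

section \<open>Realizing and omitting a non-isolated type\<close>

text \<open>Existential quantification over the variables of \<phi> yields a formula in
  \<open>n\<close> variables that captures exactly what \<phi> says about the tuple of variables
  \<open>t 0\<close>, ..., \<open>t (n - 1)\<close>.\<close>

lemma ex_projection:
  fixes M :: "'a struct"
  assumes M: "is_struct M"
  shows "\<exists>\<theta>. fv \<theta> \<subseteq> {..<n} \<and> (\<forall>s. range s \<subseteq> fst M \<longrightarrow>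
    sat M s \<theta> \<longleftrightarrow> (\<exists>u. range u \<subseteq> fst M \<and> sat M u \<phi> \<and> (\<forall>i<n. s i = u (t i))))"
proof -
  \<comment> \<open>Shifting by \<open>n\<close> keeps the quantified variables apart from the free
    variables below \<open>n\<close>.\<close>
  define B where "B = (\<lambda>i. i + n) ` (fv \<phi> \<union> t ` {..<n})"
  have "finite B" by (simp add: B_def)
  then obtain l where l: "set l = B" using finite_list by blast
  define E where "E = (\<lambda>i. Eq i (t i + n)) ` {..<n}"
  have E: "finite E" by (simp add: E_def)
  have sat_E: "sat M s (big_conj E) \<longleftrightarrow> (\<forall>i<n. s i = s (t i + n))" for s
    unfolding sat_big_conj[OF E M] by (auto simp: E_def)
  define \<theta> where "\<theta> = foldr Exi l (Conj (ren \<phi> (\<lambda>i. i + n)) (big_conj E))"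
  have "fv \<theta> \<subseteq> {..<n}"
  proof -
    have "fv (ren \<phi> (\<lambda>i. i + n)) \<subseteq> B"
      by (rule order_trans[OF fv_ren]) (auto simp: B_def)
    moreover have "fv (big_conj E) \<subseteq> {..<n} \<union> B"
      unfolding fv_big_conj[OF E] by (auto simp: E_def B_def)
    ultimately show ?thesis by (auto simp: \<theta>_def fv_foldr_Exi l)
  qed
  moreover have "sat M s \<theta> \<longleftrightarrow>
      (\<exists>u. range u \<subseteq> fst M \<and> sat M u \<phi> \<and> (\<forall>i<n. s i = u (t i)))"
    if s: "range s \<subseteq> fst M" for s
  proof
    assume "sat M s \<theta>"
    then obtain s' where s': "\<forall>x. x \<notin> B \<longrightarrow> s' x = s x" "\<forall>x\<in>B. s' x \<in> fst M"
      "sat M (s' \<circ> (\<lambda>i. i + n)) \<phi>" "\<forall>i<n. s' i = s' (t i + n)"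
      by (auto simp: \<theta>_def sat_foldr_Exi l sat_ren sat_E)
    have "range s' \<subseteq> fst M" using s s'(1,2) by (metis image_subset_iff)
    moreover have "s' i = s i" if "i < n" for i
    proof -
      have "i \<notin> B" using that by (auto simp: B_def)
      then show ?thesis using s'(1) by blast
    qed
    ultimately show "\<exists>u. range u \<subseteq> fst M \<and> sat M u \<phi> \<and> (\<forall>i<n. s i = u (t i))"
      using s'(3,4) by (intro exI[of _ "s' \<circ> (\<lambda>i. i + n)"]) auto
  next
    assume "\<exists>u. range u \<subseteq> fst M \<and> sat M u \<phi> \<and> (\<forall>i<n. s i = u (t i))"
    then obtain u where u: "range u \<subseteq> fst M" "sat M u \<phi>" "\<forall>i<n. s i = u (t i)" by blast
    define s' where "s' = (\<lambda>x. if x \<in> B then u (x - n) else s x)"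
    have "sat M (s' \<circ> (\<lambda>i. i + n)) \<phi> = sat M u \<phi>"
      by (rule sat_cong) (auto simp: s'_def B_def)
    moreover have "s' i = s' (t i + n)" if "i < n" for i
      using that u(3) by (auto simp: s'_def B_def)
    ultimately show "sat M s \<theta>"
      unfolding \<theta>_def sat_foldr_Exi l using u
      by (intro exI[of _ s']) (auto simp: sat_ren sat_E s'_def)
  qed
  ultimately show ?thesis by blast
qed

text \<open>If finitely many complete formulas never cover all \<open>n\<close>-tuples, some type
  contains no complete formula. One countable model realizes it and another omits it.\<close>

lemma ex_nonisomorphic_models:
  fixes M :: "'a struct"
  assumes M: "is_struct M" and "\<not> ryll_nardzewski M"
  shows "\<exists>(N1 :: nat struct) (N2 :: nat struct). is_struct N1 \<and> is_struct N2 \<and> elem_equiv M N1 \<and> elem_equiv M N2 \<and>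
    \<not> isomorphic N1 N2"
proof -
  obtain n where n: "\<And>\<Theta>. finite \<Theta> \<Longrightarrow> (\<And>\<theta>. \<theta> \<in> \<Theta> \<Longrightarrow> complete_fm M n \<theta>) \<Longrightarrow>
      \<exists>s. range s \<subseteq> fst M \<and> (\<forall>\<theta>\<in>\<Theta>. \<not> sat M s \<theta>)"
  proof -
    obtain n where "\<not> (\<exists>\<Theta>. finite \<Theta> \<and> (\<forall>\<theta>\<in>\<Theta>. complete_fm M n \<theta>) \<and>
        (\<forall>s. range s \<subseteq> fst M \<longrightarrow> (\<exists>\<theta>\<in>\<Theta>. sat M s \<theta>)))"
      using assms(2) unfolding ryll_nardzewski_def by (elim not_all[THEN iffD1, THEN exE])
    then show thesis by (intro that[of n]) metis
  qed
  \<comment> \<open>Any type extending \<Gamma> is non-isolated.\<close>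
  define \<Gamma> where "\<Gamma> = Neg ` {\<theta>. complete_fm M n \<theta>}"
  have con: "consistent M \<Gamma> TT"
    unfolding consistent_def
  proof (intro allI impI)
    fix G assume "finite G \<and> G \<subseteq> \<Gamma>"
    then obtain \<Theta> where "finite \<Theta>" "\<Theta> \<subseteq> {\<theta>. complete_fm M n \<theta>}" "G = Neg ` \<Theta>"
      unfolding \<Gamma>_def by (meson finite_subset_image)
    then show "\<exists>s. range s \<subseteq> fst M \<and> (\<forall>\<gamma>\<in>G. sat M s \<gamma>) \<and> sat M s TT"
      using n[of \<Theta>] M by auto
  qed
  have "fv \<gamma> \<subseteq> {..<n}" if "\<gamma> \<in> \<Gamma>" for \<gamma> using that by (auto simp: \<Gamma>_def complete_fm_def)
  moreover have "\<exists>\<psi>\<in>{TT}. consistent M \<Gamma> (Conj \<phi> \<psi>)" if "consistent M \<Gamma> \<phi>" for \<phi>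
    using that M by (simp add: consistent_def)
  ultimately obtain N1 :: "nat struct" and v1 where N1: "is_struct N1" "range v1 = fst N1"
      "elem_equiv M N1" "\<And>\<gamma>. \<gamma> \<in> \<Gamma> \<Longrightarrow> sat N1 v1 \<gamma>"
    using generic_model[OF M _ con, of n "\<lambda>_. {TT}"] by blast
  \<comment> \<open>The type realized in \<open>N1\<close> by the first \<open>n\<close> values of
    \<open>v1\<close>; it includes \<Gamma>.\<close>
  define p where "p = {\<pi>. fv \<pi> \<subseteq> {..<n} \<and> sat N1 v1 \<pi>}"
  \<comment> \<open>Here \<open>k\<close> codes a list of variables, and \<open>E k\<close> demands
    that this tuple violate some member of \<open>p\<close>.\<close>
  define E where "E k = {Neg (ren \<pi> (\<lambda>i. from_nat k ! i)) | \<pi>. \<pi> \<in> p}" for k :: nat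
  \<comment> \<open>Density of \<open>E k\<close>: otherwise \<phi> forces all of \<open>p\<close>
    on the tuple, so its projection \<theta> is a complete formula. Then \<open>Neg \<theta>\<close>
    lies in \<Gamma>, hence in \<open>p\<close>, and the satisfiable \<theta> implies its own
    negation.\<close>
  have "\<exists>\<psi>\<in>E k. consistent M {} (Conj \<phi> \<psi>)" if \<phi>: "consistent M {} \<phi>" for k \<phi>
  proof (rule ccontr)
    assume neg: "\<not> ?thesis"
    define t where "t = (\<lambda>i. from_nat k ! i :: nat)"
    have imp: "sat M (u \<circ> t) \<pi>" if "range u \<subseteq> fst M" "sat M u \<phi>" "\<pi> \<in> p" for u \<pi>
      using neg that unfolding E_def t_def[symmetric]
      by (auto simp: consistent_empty_iff sat_ren)
    obtain \<theta> where \<theta>: "fv \<theta> \<subseteq> {..<n}" "\<forall>s. range s \<subseteq> fst M \<longrightarrow>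
      sat M s \<theta> \<longleftrightarrow> (\<exists>u. range u \<subseteq> fst M \<and> sat M u \<phi> \<and> (\<forall>i<n. s i = u (t i)))"
      using ex_projection[OF M, of n \<phi> t] by (elim exE conjE)
    have imp': "fm_implies M \<theta> \<pi>" if "\<pi> \<in> p" for \<pi>
    proof (unfold fm_implies_def, intro allI impI)
      fix s :: "nat \<Rightarrow> 'a" assume "range s \<subseteq> fst M" "sat M s \<theta>"
      then obtain u where u: "range u \<subseteq> fst M" "sat M u \<phi>" "\<forall>i<n. s i = u (t i)"
        using \<theta>(2) by blast
      have "sat M s \<pi> = sat M (u \<circ> t) \<pi>"
        by (rule sat_cong) (use u that in \<open>auto simp: p_def\<close>)
      then show "sat M s \<pi>" using imp[OF u(1,2) that] by simp
    qed
    have "complete_fm M n \<theta>"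
      unfolding complete_fm_def
    proof (intro conjI allI impI \<theta>(1))
      fix \<pi> assume "fv \<pi> \<subseteq> {..<n}"
      then have "\<pi> \<in> p \<or> Neg \<pi> \<in> p" by (auto simp: p_def)
      then show "fm_implies M \<theta> \<pi> \<or> fm_implies M \<theta> (Neg \<pi>)" using imp' by blast
    qed
    then have "Neg \<theta> \<in> \<Gamma>" by (simp add: \<Gamma>_def)
    then have "Neg \<theta> \<in> p" using N1(4)[of "Neg \<theta>"] \<theta>(1) by (simp add: p_def)
    then have "fm_implies M \<theta> (Neg \<theta>)" by (rule imp')
    moreover obtain u where u: "range u \<subseteq> fst M" "sat M u \<phi>"
      using \<phi> by (auto simp: consistent_empty_iff)
    moreover have ut: "range (u \<circ> t) \<subseteq> fst M" using u(1) by auto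
    moreover have "sat M (u \<circ> t) \<theta>" using \<theta>(2)[rule_format, OF ut] u by auto
    ultimately show False by (auto simp: fm_implies_def)
  qed
  moreover have "consistent M {} TT"
    using M ex_valuation[OF M] by (auto simp: consistent_empty_iff)
  ultimately obtain N2 :: "nat struct" and v2 where N2: "is_struct N2" "range v2 = fst N2"
      "elem_equiv M N2" "\<And>k. \<exists>\<psi>\<in>E k. sat N2 v2 \<psi>"
    using generic_model[OF M, of "{}" 0 E] by blast
  have "\<not> isomorphic N1 N2"
  proof
    assume "isomorphic N1 N2"
    then obtain f where f: "bij_betw f (fst N1) (fst N2)"
      "\<And>x y. x \<in> fst N1 \<Longrightarrow> y \<in> fst N1 \<Longrightarrow> (x, y) \<in> snd N1 \<longleftrightarrow> (f x, f y) \<in> snd N2"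
      unfolding isomorphic_def by blast
    \<comment> \<open>As \<open>v2\<close> is onto, the image of the realizing tuple is named by
      variables; their list has a code \<open>k\<close>, and \<open>E k\<close> says that this tuple
      does not realize \<open>p\<close>.\<close>
    have "\<exists>j. f (v1 i) = v2 j" for i
      using f(1) N1(2) N2(2) by (metis bij_betwE rangeE rangeI)
    then obtain t where t: "\<And>i. f (v1 i) = v2 (t i)" by metis
    obtain \<pi> where \<pi>: "\<pi> \<in> p" "sat N2 v2 (Neg (ren \<pi> (\<lambda>i. from_nat (to_nat (map t [0..<n])) ! i)))"
      using N2(4)[of "to_nat (map t [0..<n])"] unfolding E_def by blast
    have "sat N2 (v2 \<circ> (\<lambda>i. map t [0..<n] ! i)) \<pi> = sat N2 (f \<circ> v1) \<pi>"
      by (rule sat_cong) (use \<pi>(1) t in \<open>auto simp: p_def\<close>)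
    also have "\<dots> = sat N1 v1 \<pi>"
      using isomorphic_sat[OF f] N1(2) by simp
    finally show False using \<pi> by (simp add: sat_ren p_def)
  qed
  with N1(1,3) N2(1,3) show ?thesis by blast
qed

section \<open>Finitely many types\<close>

text \<open>Each of finitely many realized types is isolated by a conjunction of formulas that
  separate it from the others.\<close>

lemma finite_types_imp_complete_fms:
  fixes M :: "'a struct"
  assumes M: "is_struct M"
    and fin: "finite ((\<lambda>s. {\<phi>. fv \<phi> \<subseteq> {..<n} \<and> sat M s \<phi>}) ` {s. range s \<subseteq> fst M})"
  shows "\<exists>\<Theta>. finite \<Theta> \<and> (\<forall>\<theta>\<in>\<Theta>. complete_fm M n \<theta>) \<and>
     (\<forall>s. range s \<subseteq> fst M \<longrightarrow> (\<exists>\<theta>\<in>\<Theta>. sat M s \<theta>))"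
proof -
  define tp where "tp s = {\<phi>. fv \<phi> \<subseteq> {..<n} \<and> sat M s \<phi>}" for s
  define P where "P = tp ` {s. range s \<subseteq> fst M}"
  have P: "finite P" using fin by (simp add: P_def tp_def[abs_def])
  have "\<exists>\<phi>. \<phi> \<in> p \<and> \<phi> \<notin> q" if pq: "p \<in> P" "q \<in> P" "p \<noteq> q" for p q
  proof -
    obtain s s' where s: "p = tp s" "q = tp s'" using pq by (auto simp: P_def)
    obtain \<phi> where "fv \<phi> \<subseteq> {..<n}" "sat M s \<phi> \<noteq> sat M s' \<phi>"
      using pq(3) unfolding s by (auto simp: tp_def)
    \<comment> \<open>Types are closed under choosing a formula or its negation, so the separating
      formula can be taken from \<open>p\<close>.\<close>
    then have "\<phi> \<in> p \<and> \<phi> \<notin> q \<or> Neg \<phi> \<in> p \<and> Neg \<phi> \<notin> q" by (auto simp: s tp_def)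
    then show ?thesis by blast
  qed
  note ex = this
  define g where "g p q = (SOME \<phi>. \<phi> \<in> p \<and> \<phi> \<notin> q)" for p q :: "fm set"
  have g: "g p q \<in> p \<and> g p q \<notin> q" if "p \<in> P" "q \<in> P" "p \<noteq> q" for p q
    unfolding g_def by (rule someI_ex) (rule ex[OF that])
  define \<theta> where "\<theta> p = big_conj (g p ` (P - {p}))" for p
  have fv: "fv (\<theta> p) \<subseteq> {..<n}" if "p \<in> P" for p
  proof -
    have "fv (g p q) \<subseteq> {..<n}" if "q \<in> P - {p}" for q
      using g[OF \<open>p \<in> P\<close>, of q] that \<open>p \<in> P\<close> by (auto simp: P_def tp_def)
    then show ?thesis using P by (auto simp: \<theta>_def fv_big_conj)
  qed
  have \<theta>: "sat M s (\<theta> p) \<longleftrightarrow> tp s = p" if "range s \<subseteq> fst M" "p \<in> P" for s p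
  proof -
    have "tp s \<in> P" using that by (auto simp: P_def)
    moreover have "sat M s (\<theta> p) \<longleftrightarrow> (\<forall>q\<in>P - {p}. sat M s (g p q))"
      using P M by (simp add: \<theta>_def sat_big_conj)
    moreover have "fv (g p q) \<subseteq> {..<n}" if "q \<in> P" "p \<noteq> q" for q
      using g[OF \<open>p \<in> P\<close> that] \<open>p \<in> P\<close> by (auto simp: P_def tp_def)
    ultimately have *: "sat M s (\<theta> p) \<longleftrightarrow> (\<forall>q\<in>P - {p}. g p q \<in> tp s)"
      by (auto simp: tp_def)
    show ?thesis
    proof
      assume "sat M s (\<theta> p)"
      then show "tp s = p" using * g[OF that(2) \<open>tp s \<in> P\<close>] \<open>tp s \<in> P\<close> by blast
    next
      assume "tp s = p"
      then show "sat M s (\<theta> p)" using * g[OF that(2)] by auto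
    qed
  qed
  have "complete_fm M n (\<theta> p)" if p: "p \<in> P" for p
    unfolding complete_fm_def
  proof (intro conjI allI impI fv p)
    fix \<pi> assume "fv \<pi> \<subseteq> {..<n}"
    then have "sat M s \<pi> \<longleftrightarrow> \<pi> \<in> tp s" for s by (simp add: tp_def)
    then show "fm_implies M (\<theta> p) \<pi> \<or> fm_implies M (\<theta> p) (Neg \<pi>)"
      using \<theta>[OF _ p] by (auto simp: fm_implies_def)
  qed
  moreover have "\<exists>\<psi>\<in>\<theta> ` P. sat M s \<psi>" if "range s \<subseteq> fst M" for s
    using \<theta>[OF that, of "tp s"] that by (auto simp: P_def)
  ultimately show ?thesis using P by (intro exI[of _ "\<theta> ` P"]) auto
qed

text \<open>An \<open>n\<close>-type depends only on the first \<open>n\<close> values of the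
  valuation, and a finite domain has finitely many such tuples.\<close>

lemma finite_imp_ryll_nardzewski:
  assumes M: "is_struct M" and fin: "finite (fst M)"
  shows "ryll_nardzewski M"
  unfolding ryll_nardzewski_def
proof (intro allI finite_types_imp_complete_fms M)
  fix n
  define h where "h l = {\<phi>. fv \<phi> \<subseteq> {..<n} \<and> sat M (\<lambda>i. l ! i) \<phi>}" for l
  have "sat M s \<phi> = sat M (\<lambda>i. map s [0..<n] ! i) \<phi>" if "fv \<phi> \<subseteq> {..<n}" for s \<phi>
    by (rule sat_cong) (use that in auto)
  then have "{\<phi>. fv \<phi> \<subseteq> {..<n} \<and> sat M s \<phi>} = h (map s [0..<n])" for s
    unfolding h_def by blast
  then have "(\<lambda>s. {\<phi>. fv \<phi> \<subseteq> {..<n} \<and> sat M s \<phi>}) ` {s. range s \<subseteq> fst M}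
      \<subseteq> h ` {l. set l \<subseteq> fst M \<and> length l = n}" by (auto intro!: imageI simp: image_subset_iff)
  then show "finite ((\<lambda>s. {\<phi>. fv \<phi> \<subseteq> {..<n} \<and> sat M s \<phi>}) ` {s. range s \<subseteq> fst M})"
    by (rule finite_subset) (simp add: finite_lists_length_eq fin)
qed

lemma is_struct_nonempty: "is_struct M \<Longrightarrow> fst M \<noteq> {}"
  by (simp add: is_struct_def)

lemma elem_equiv_implies:
  assumes "is_struct M" "is_struct N" "elem_equiv M N"
  shows "fm_implies M \<phi> \<psi> = fm_implies N \<phi> \<psi>"
  unfolding fm_implies_iff_holds by (rule elem_equiv_holds[OF assms])

text \<open>Covering by the finite set \<Theta> is a single formula and completeness a family of
  valid implications, so both transfer.\<close>

lemma elem_equiv_ryll_nardzewski: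
  fixes M :: "'a struct" and N :: "'b struct"
  assumes MN: "is_struct M" "is_struct N" "elem_equiv M N" and "ryll_nardzewski M"
  shows "ryll_nardzewski N"
  unfolding ryll_nardzewski_def
proof
  fix n
  obtain \<Theta> where \<Theta>: "finite \<Theta>" "\<forall>\<theta>\<in>\<Theta>. complete_fm M n \<theta>"
    and cover: "\<forall>s. range s \<subseteq> fst M \<longrightarrow> (\<exists>\<theta>\<in>\<Theta>. sat M s \<theta>)"
    using assms(4) unfolding ryll_nardzewski_def by (elim allE[of _ n] exE conjE)
  have "holds M (Neg (big_conj (Neg ` \<Theta>)))"
    using \<Theta>(1) cover MN(1) by (simp add: holds_def sat_big_conj)
  then have "holds N (Neg (big_conj (Neg ` \<Theta>)))" using elem_equiv_holds[OF MN] by blast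
  then have "\<forall>s. range s \<subseteq> fst N \<longrightarrow> (\<exists>\<theta>\<in>\<Theta>. sat N s \<theta>)" 
    using \<Theta>(1) MN(2) by (simp add: holds_def sat_big_conj)
  moreover have "\<forall>\<theta>\<in>\<Theta>. complete_fm N n \<theta>"
    using \<Theta>(2) by (simp add: complete_fm_def elem_equiv_implies[OF MN])
  ultimately show "\<exists>\<Theta>. finite \<Theta> \<and> (\<forall>\<theta>\<in>\<Theta>. complete_fm N n \<theta>) \<and>
     (\<forall>s. range s \<subseteq> fst N \<longrightarrow> (\<exists>\<theta>\<in>\<Theta>. sat N s \<theta>))"
    using \<Theta>(1) by (intro exI[of _ \<Theta>] conjI)
qed

section \<open>Back-and-forth\<close>

text \<open>Total valuations stand for \<open>n\<close>-tuples; only their values below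
  \<open>n\<close> matter for the types.\<close>

definition same_type :: "nat \<Rightarrow> 'a struct \<Rightarrow> 'b struct \<Rightarrow> (nat \<Rightarrow> 'a) \<Rightarrow> (nat \<Rightarrow> 'b) \<Rightarrow> bool" where
  "same_type n M N s s' \<longleftrightarrow> range s \<subseteq> fst M \<and> range s' \<subseteq> fst N \<and>
     (\<forall>\<phi>. fv \<phi> \<subseteq> {..<n} \<longrightarrow> sat M s \<phi> = sat N s' \<phi>)"

lemma same_type_sym: "same_type n M N s s' \<Longrightarrow> same_type n N M s' s"
  by (auto simp: same_type_def)

text \<open>If \<theta> isolates the type of the extended tuple, then \<open>Exi n \<theta>\<close>
  belongs to the type of the old tuple. A witness for it on the other side has the right type,
  because \<theta> decides every formula in the same way in \<open>N\<close>.\<close>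

lemma same_type_extend:
  fixes M :: "'a struct" and N :: "'b struct"
  assumes MN: "is_struct M" "is_struct N" "elem_equiv M N" and RN: "ryll_nardzewski M"
    and ss: "same_type n M N s s'" and c: "c \<in> fst M"
  shows "\<exists>d\<in>fst N. same_type (Suc n) M N (s(n := c)) (s'(n := d))"
proof -
  obtain \<Theta> where \<Theta>: "\<forall>\<theta>\<in>\<Theta>. complete_fm M (Suc n) \<theta>"
    and cover: "\<forall>s. range s \<subseteq> fst M \<longrightarrow> (\<exists>\<theta>\<in>\<Theta>. sat M s \<theta>)"
    using RN unfolding ryll_nardzewski_def by (elim allE[of _ "Suc n"] exE conjE)
  have r: "range (s(n := c)) \<subseteq> fst M" using ss c by (auto simp: same_type_def)
  then obtain \<theta> where \<theta>: "\<theta> \<in> \<Theta>" "sat M (s(n := c)) \<theta>" using cover by blast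
  have "fv (Exi n \<theta>) \<subseteq> {..<n}" 
    using \<Theta> \<theta>(1) unfolding complete_fm_def lessThan_Suc by auto
  moreover have "sat M s (Exi n \<theta>)" using \<theta>(2) c by auto
  ultimately have "sat N s' (Exi n \<theta>)" using ss unfolding same_type_def by blast
  then obtain d where d: "d \<in> fst N" "sat N (s'(n := d)) \<theta>" by auto
  have r': "range (s'(n := d)) \<subseteq> fst N" using ss d by (auto simp: same_type_def)
  have "sat M (s(n := c)) \<pi> = sat N (s'(n := d)) \<pi>" if "fv \<pi> \<subseteq> {..<Suc n}" for \<pi>
  proof -
    have "fm_implies M \<theta> \<pi> \<or> fm_implies M \<theta> (Neg \<pi>)"
      using \<Theta> \<theta>(1) that by (simp add: complete_fm_def)
    then have "fm_implies M \<theta> \<pi> \<and> fm_implies N \<theta> \<pi> \<or> fm_implies M \<theta> (Neg \<pi>) \<and> fm_implies N \<theta> (Neg \<pi>)"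
      using elem_equiv_implies[OF MN] by blast
    then show ?thesis using \<theta>(2) d(2) r r' by (auto simp: fm_implies_def)
  qed
  then show ?thesis using d(1) r r' unfolding same_type_def by blast
qed

lemma isomorphic_if_ryll_nardzewski:
  fixes M :: "'a struct" and N :: "'b struct"
  assumes MN: "is_struct M" "is_struct N" "elem_equiv M N" and RN: "ryll_nardzewski M"
    and cM: "countable (fst M)" and cN: "countable (fst N)"
  shows "isomorphic M N"
proof -
  have RN': "ryll_nardzewski N" by (rule elem_equiv_ryll_nardzewski[OF MN RN])
  define eM where "eM = from_nat_into (fst M)"
  define eN where "eN = from_nat_into (fst N)"
  have eM: "range eM = fst M"
    unfolding eM_def using MN(1) cM by (intro range_from_nat_into is_struct_nonempty)
  have eN: "range eN = fst N"
    unfolding eN_def using MN(2) cN by (intro range_from_nat_into is_struct_nonempty)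
  define P where "P n p \<longleftrightarrow> same_type n M N (fst p) (snd p)" for n p
  \<comment> \<open>Stage \<open>n\<close> keeps the positions below \<open>n\<close> and fills
    position \<open>n\<close>: even stages exhaust \<open>M\<close>, odd stages exhaust
    \<open>N\<close>.\<close>
  define Q where "Q n p q \<longleftrightarrow> (\<forall>x<n. fst q x = fst p x \<and> snd q x = snd p x) \<and>
      (if even n then fst q n = eM (n div 2) else snd q n = eN (n div 2))"
    for n and p q :: "(nat \<Rightarrow> 'a) \<times> (nat \<Rightarrow> 'b)"
  have base: "\<exists>p. P 0 p"
  proof -
    obtain s :: "nat \<Rightarrow> 'a" where s: "range s \<subseteq> fst M" using ex_valuation[OF MN(1)] by blast
    obtain s' :: "nat \<Rightarrow> 'b" where s': "range s' \<subseteq> fst N" using ex_valuation[OF MN(2)] by blast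
    have "sat M s \<phi> = sat N s' \<phi>" if "fv \<phi> \<subseteq> {..<0}" for \<phi>
      using that MN(3) holds_sentence[OF _ s, of \<phi>] holds_sentence[OF _ s', of \<phi>]
      by (simp add: elem_equiv_def sentence_def)
    then show ?thesis using s s' by (intro exI[of _ "(s, s')"]) (simp add: P_def same_type_def)
  qed
  have step: "\<exists>q. P (Suc n) q \<and> Q n p q" if p: "P n p" for n p
  proof (cases "even n")
    case True
    obtain d where "same_type (Suc n) M N ((fst p)(n := eM (n div 2))) ((snd p)(n := d))"
      using same_type_extend[OF MN RN p[unfolded P_def], of "eM (n div 2)"] eM by blast
    then show ?thesis using True
      by (intro exI[of _ "((fst p)(n := eM (n div 2)), (snd p)(n := d))"])
        (auto simp: P_def Q_def)
  next
    case False
    obtain d where "same_type (Suc n) N M ((snd p)(n := eN (n div 2))) ((fst p)(n := d))"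
      using same_type_extend[OF MN(2,1) elem_equiv_sym[OF MN(3)] RN'
          same_type_sym[OF p[unfolded P_def]], of "eN (n div 2)"] eN by blast
    then show ?thesis using False
      by (intro exI[of _ "((fst p)(n := d), (snd p)(n := eN (n div 2)))"])
        (auto simp: P_def Q_def intro: same_type_sym)
  qed
  obtain c where P: "\<And>n. P n (c n)" and Q: "\<And>n. Q n (c n) (c (Suc n))"
    using dependent_nat_choice[of P Q, OF base step] by blast
  \<comment> \<open>Position \<open>x\<close> is filled at stage \<open>x\<close> and never changes
    afterwards, so \<open>c (Suc x)\<close> already shows its final value.\<close>
  define u where "u x = fst (c (Suc x)) x" for x
  define u' where "u' x = snd (c (Suc x)) x" for x
  have lim: "fst (c n) x = u x \<and> snd (c n) x = u' x" if "x < n" for n x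
    using Suc_leI[OF that]
  proof (induction n rule: dec_induct)
    case base show ?case by (simp add: u_def u'_def)
  next
    case (step n)
    then show ?case using Q[of n] by (simp add: Q_def)
  qed
  have sat: "sat M u \<phi> = sat N u' \<phi>" for \<phi>
  proof -
    obtain n where n: "fv \<phi> \<subseteq> {..<n}"
      using finite_nat_iff_bounded[of "fv \<phi>"] by auto
    have "sat M u \<phi> = sat M (fst (c n)) \<phi>" by (rule sat_cong) (use n lim in auto)
    also have "\<dots> = sat N (snd (c n)) \<phi>" using P[of n] n by (simp add: P_def same_type_def)
    also have "\<dots> = sat N u' \<phi>" by (rule sat_cong) (use n lim in auto)
    finally show ?thesis .
  qed
  have "u x \<in> fst M" "u' x \<in> fst N" for x
    using P[of "Suc x"] by (auto simp: P_def same_type_def u_def u'_def image_subset_iff)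
  moreover have "eM k \<in> range u" for k
  proof -
    have "u (2 * k) = eM k" using Q[of "2 * k"] by (simp add: Q_def u_def)
    then show ?thesis by (metis rangeI)
  qed
  moreover have "eN k \<in> range u'" for k
  proof -
    have "u' (Suc (2 * k)) = eN k" using Q[of "Suc (2 * k)"] by (simp add: Q_def u'_def)
    then show ?thesis by (metis rangeI)
  qed
  ultimately have ran: "range u = fst M" "range u' = fst N"
    by (auto simp flip: eM eN)
  have eq: "u x = u y \<longleftrightarrow> u' x = u' y" for x y using sat[of "Eq x y"] by simp
  have le: "(u x, u y) \<in> snd M \<longleftrightarrow> (u' x, u' y) \<in> snd N" for x y using sat[of "Le x y"] by simp
  \<comment> \<open>The choice of \<open>x\<close> does not matter, since \<open>u\<close> and
    \<open>u'\<close> satisfy the same equations.\<close>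
  define f where "f a = u' (SOME x. u x = a)" for a
  have f: "f (u x) = u' x" for x
    unfolding f_def eq[symmetric] by (rule someI[of _ x]) simp
  have "bij_betw f (fst M) (fst N)"
    unfolding bij_betw_def ran[symmetric] by (auto simp: inj_on_def f eq image_image)
  moreover have "\<forall>x\<in>fst M. \<forall>y\<in>fst M. (x, y) \<in> snd M \<longleftrightarrow> (f x, f y) \<in> snd N"
    unfolding ran[symmetric] by (auto simp: f le)
  ultimately show ?thesis unfolding isomorphic_def by blast
qed

section \<open>Lexicographic sums\<close>

text \<open>Here \<open>\<sigma> x\<close> is the index of the summand in which the variable \<open>x\<close> is interpreted.\<close>

definition agree ::
  "fm set \<Rightarrow> 'i struct \<Rightarrow> ('i \<Rightarrow> 'a struct) \<Rightarrow> ('i \<Rightarrow> 'b struct) \<Rightarrow> nat set \<Rightarrow> (nat \<Rightarrow> 'i) \<Rightarrow>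
     (nat \<Rightarrow> 'a) \<Rightarrow> (nat \<Rightarrow> 'b) \<Rightarrow> bool" where
  "agree F J A B V \<sigma> s s' \<longleftrightarrow>
     (\<forall>i\<in>fst J. \<forall>\<psi>\<in>F. fv \<psi> \<subseteq> {x \<in> V. \<sigma> x = i} \<longrightarrow> sat (A i) s \<psi> = sat (B i) s' \<psi>)"

lemma agree_sym: "agree F J A B V \<sigma> s s' \<Longrightarrow> agree F J B A V \<sigma> s' s"
  by (auto simp: agree_def)

lemma agree_mono: "agree F J A B V \<sigma> s s' \<Longrightarrow> F' \<subseteq> F \<Longrightarrow> agree F' J A B V \<sigma> s s'"
  by (auto simp: agree_def)

text \<open>Each pair \<open>(G, H)\<close> is a possible pattern of true and false formulas at a
  value of \<open>n\<close>; the added formula says that the pattern occurs.\<close>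

definition refine :: "nat \<Rightarrow> fm set \<Rightarrow> fm set" where
  "refine n F =
     F \<union> (\<lambda>(G, H). Exi n (Conj (big_conj G) (big_conj (Neg ` H)))) ` (Pow F \<times> Pow F)"

lemma finite_refine: "finite F \<Longrightarrow> finite (refine n F)"
  by (simp add: refine_def)

text \<open>The pattern of truth values of \<open>F\<close> at \<open>a\<close> in summand
  \<open>i\<close> is one existential formula of \<open>refine n F\<close>. It holds in
  \<open>B i\<close> by agreement, and any witness serves as \<open>b\<close>.\<close>

lemma agree_extend:
  assumes F: "finite F" and st: "is_struct (A i)" "is_struct (B i)" and i: "i \<in> fst J"
    and ag: "agree (refine n F) J A B V \<sigma> s s'" and a: "a \<in> fst (A i)"
  shows "\<exists>b\<in>fst (B i). agree F J A B (insert n V) (\<sigma>(n := i)) (s(n := a)) (s'(n := b))"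
proof -
  \<comment> \<open>Variable \<open>n\<close> now points to summand \<open>i\<close>, even if
    \<sigma> placed it elsewhere before.\<close>
  define Fi where "Fi = {\<psi> \<in> F. fv \<psi> \<subseteq> {x \<in> insert n V. (\<sigma>(n := i)) x = i}}"
  define G where "G = {\<psi> \<in> Fi. sat (A i) (s(n := a)) \<psi>}"
  define H where "H = Fi - G"
  have fin: "finite G" "finite H" "finite (Neg ` H)" using F by (auto simp: Fi_def G_def H_def)
  define \<chi> where "\<chi> = Exi n (Conj (big_conj G) (big_conj (Neg ` H)))"
  have "(G, H) \<in> Pow F \<times> Pow F" by (auto simp: Fi_def G_def H_def)
  then have "\<chi> \<in> refine n F" unfolding refine_def \<chi>_def by force
  moreover have "fv \<chi> \<subseteq> {x \<in> V. \<sigma> x = i}"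
  proof -
    have "fv \<psi> - {n} \<subseteq> {x \<in> V. \<sigma> x = i}" if "\<psi> \<in> Fi" for \<psi>
      using that by (auto simp: Fi_def split: if_splits)
    then show ?thesis unfolding \<chi>_def
      by (simp add: fv_big_conj fin) (auto simp: G_def H_def)
  qed
  moreover have "sat (A i) s \<chi>"
  proof -
    have "sat (A i) (s(n := a)) (big_conj G)" "sat (A i) (s(n := a)) (big_conj (Neg ` H))"
      using fin st by (simp_all add: sat_big_conj) (auto simp: G_def H_def)
    then show ?thesis using a by (auto simp: \<chi>_def)
  qed
  ultimately have "sat (B i) s' \<chi>" using ag i unfolding agree_def by blast
  then obtain b where b: "b \<in> fst (B i)" "\<forall>\<psi>\<in>G. sat (B i) (s'(n := b)) \<psi>"
    "\<forall>\<psi>\<in>H. \<not> sat (B i) (s'(n := b)) \<psi>"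
    unfolding \<chi>_def by (auto simp: sat_big_conj fin st)
  have "sat (A j) (s(n := a)) \<psi> = sat (B j) (s'(n := b)) \<psi>"
    if j: "j \<in> fst J" and \<psi>: "\<psi> \<in> F" "fv \<psi> \<subseteq> {x \<in> insert n V. (\<sigma>(n := i)) x = j}" for j \<psi>
  proof (cases "j = i")
    case True
    then have "\<psi> \<in> Fi" using \<psi> by (simp add: Fi_def)
    then show ?thesis using b True by (auto simp: G_def H_def)
  next
    case False
    \<comment> \<open>Formulas about another summand do not mention \<open>n\<close>, so the old
      agreement still applies.\<close>
    have fv: "fv \<psi> \<subseteq> {x \<in> V. \<sigma> x = j}" "n \<notin> fv \<psi>" using \<psi>(2) False by (auto split: if_splits)
    have "sat (A j) (s(n := a)) \<psi> = sat (A j) s \<psi>" by (rule sat_cong) (use fv in auto)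
    also have "\<dots> = sat (B j) s' \<psi>"
      using ag j \<psi>(1) fv(1) unfolding agree_def refine_def by blast
    also have "\<dots> = sat (B j) (s'(n := b)) \<psi>" by (rule sat_cong) (use fv in auto)
    finally show ?thesis .
  qed
  then show ?thesis using b(1) unfolding agree_def by blast
qed

definition disjoint_structs :: "'i struct \<Rightarrow> ('i \<Rightarrow> 'a struct) \<Rightarrow> bool" where
  "disjoint_structs J A \<longleftrightarrow> (\<forall>i\<in>fst J. is_struct (A i)) \<and>
     (\<forall>i\<in>fst J. \<forall>j\<in>fst J. i \<noteq> j \<longrightarrow> fst (A i) \<inter> fst (A j) = {})"

lemma fst_lex_sum: "fst (lex_sum J A) = (\<Union>i\<in>fst J. fst (A i))"
  by (simp add: lex_sum_def)

lemma disjoint_structsD: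
  "disjoint_structs J A \<Longrightarrow> i \<in> fst J \<Longrightarrow> j \<in> fst J \<Longrightarrow> x \<in> fst (A i) \<Longrightarrow> x \<in> fst (A j) \<Longrightarrow> i = j"
  unfolding disjoint_structs_def by blast

lemma snd_lex_sum_iff:
  assumes "disjoint_structs J A" "i \<in> fst J" "j \<in> fst J" "x \<in> fst (A i)" "y \<in> fst (A j)"
  shows "(x, y) \<in> snd (lex_sum J A) \<longleftrightarrow> (if i = j then (x, y) \<in> snd (A i) else (i, j) \<in> snd J)"
proof -
  have x: "x \<in> fst (A k) \<longleftrightarrow> k = i" if "k \<in> fst J" for k
    using disjoint_structsD[OF assms(1) that assms(2) _ assms(4)] assms(4) by blast
  have y: "y \<in> fst (A k) \<longleftrightarrow> k = j" if "k \<in> fst J" for k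
    using disjoint_structsD[OF assms(1) that assms(3) _ assms(5)] assms(5) by blast
  have "(\<exists>k\<in>fst J. x \<in> fst (A k) \<and> y \<in> fst (A k) \<and> (x, y) \<in> snd (A k)) \<longleftrightarrow>
      i = j \<and> (x, y) \<in> snd (A i)"
    using assms(2) x y by blast
  moreover have "(\<exists>k\<in>fst J. \<exists>l\<in>fst J. x \<in> fst (A k) \<and> y \<in> fst (A l) \<and> (k, l) \<in> snd J \<and> k \<noteq> l)
      \<longleftrightarrow> (i, j) \<in> snd J \<and> i \<noteq> j"
    using assms(2,3) x y by blast
  ultimately show ?thesis by (simp add: lex_sum_def)
qed

lemma is_struct_lex_sum:
  assumes "is_struct J" "disjoint_structs J A"
  shows "is_struct (lex_sum J A)"
proof -
  obtain i where i: "i \<in> fst J" using assms(1) by (auto simp: is_struct_def)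
  then obtain x where "x \<in> fst (A i)"
    using assms(2) unfolding disjoint_structs_def is_struct_def by blast
  with i have "fst (lex_sum J A) \<noteq> {}" unfolding fst_lex_sum by blast
  moreover have "snd (lex_sum J A) \<subseteq> fst (lex_sum J A) \<times> fst (lex_sum J A)"
    unfolding lex_sum_def by (simp, blast)
  ultimately show ?thesis by (simp add: is_struct_def)
qed

text \<open>
  The finite set \<open>F\<close> depends on \<open>\<phi>\<close> only. Its finiteness makes the quantifier step work: the
  truth values in a summand of all members of \<open>F\<close> at a new element are described by one
  existential formula.
\<close>

lemma sat_lex_sum_agree:
  "\<exists>F. finite F \<and> (\<forall>(A :: 'i \<Rightarrow> 'a struct) (B :: 'i \<Rightarrow> 'b struct) V \<sigma> s s'.
     disjoint_structs J A \<longrightarrow> disjoint_structs J B \<longrightarrow> fv \<phi> \<subseteq> V \<longrightarrow>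
     (\<forall>x\<in>V. \<sigma> x \<in> fst J \<and> s x \<in> fst (A (\<sigma> x)) \<and> s' x \<in> fst (B (\<sigma> x))) \<longrightarrow>
     agree F J A B V \<sigma> s s' \<longrightarrow> sat (lex_sum J A) s \<phi> = sat (lex_sum J B) s' \<phi>)"
proof (induction \<phi>)
  case (Le m n)
  show ?case
  proof (intro exI[of _ "{Le m n}"] conjI allI impI)
    fix A :: "'i \<Rightarrow> 'a struct" and B :: "'i \<Rightarrow> 'b struct" and V \<sigma> s s'
    assume A: "disjoint_structs J A" and B: "disjoint_structs J B" and V: "fv (Le m n) \<subseteq> V"
      and s: "\<forall>x\<in>V. \<sigma> x \<in> fst J \<and> s x \<in> fst (A (\<sigma> x)) \<and> s' x \<in> fst (B (\<sigma> x))"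
      and ag: "agree {Le m n} J A B V \<sigma> s s'"
    have mn: "\<sigma> m \<in> fst J" "\<sigma> n \<in> fst J" "s m \<in> fst (A (\<sigma> m))" "s n \<in> fst (A (\<sigma> n))"
      "s' m \<in> fst (B (\<sigma> m))" "s' n \<in> fst (B (\<sigma> n))" using V s by auto
    \<comment> \<open>Only atoms within a single summand need agreement; between different summands
      the order of \<open>J\<close> decides.\<close>
    have "(s m, s n) \<in> snd (A (\<sigma> m)) \<longleftrightarrow> (s' m, s' n) \<in> snd (B (\<sigma> m))" if "\<sigma> m = \<sigma> n"
      using ag that V mn by (auto simp: agree_def)
    then show "sat (lex_sum J A) s (Le m n) = sat (lex_sum J B) s' (Le m n)"
      using snd_lex_sum_iff[OF A mn(1-4)] snd_lex_sum_iff[OF B mn(1,2,5,6)] by simp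
  qed simp
next
  case (Eq m n)
  show ?case
  proof (intro exI[of _ "{Eq m n}"] conjI allI impI)
    fix A :: "'i \<Rightarrow> 'a struct" and B :: "'i \<Rightarrow> 'b struct" and V \<sigma> s s'
    assume A: "disjoint_structs J A" and B: "disjoint_structs J B" and V: "fv (Eq m n) \<subseteq> V"
      and s: "\<forall>x\<in>V. \<sigma> x \<in> fst J \<and> s x \<in> fst (A (\<sigma> x)) \<and> s' x \<in> fst (B (\<sigma> x))"
      and ag: "agree {Eq m n} J A B V \<sigma> s s'"
    have mn: "\<sigma> m \<in> fst J" "\<sigma> n \<in> fst J" "s m \<in> fst (A (\<sigma> m))" "s n \<in> fst (A (\<sigma> n))"
      "s' m \<in> fst (B (\<sigma> m))" "s' n \<in> fst (B (\<sigma> n))" using V s by auto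
    have "s m = s n \<longleftrightarrow> s' m = s' n" if "\<sigma> m = \<sigma> n"
      using ag that V mn by (auto simp: agree_def)
    then show "sat (lex_sum J A) s (Eq m n) = sat (lex_sum J B) s' (Eq m n)"
      using disjoint_structsD[OF A mn(1,2)] disjoint_structsD[OF B mn(1,2)] mn by auto
  qed simp
next
  case (Neg \<phi>)
  then obtain F where "finite F" and F: "\<forall>(A :: 'i \<Rightarrow> 'a struct) (B :: 'i \<Rightarrow> 'b struct) V \<sigma> s s'.
     disjoint_structs J A \<longrightarrow> disjoint_structs J B \<longrightarrow> fv \<phi> \<subseteq> V \<longrightarrow>
     (\<forall>x\<in>V. \<sigma> x \<in> fst J \<and> s x \<in> fst (A (\<sigma> x)) \<and> s' x \<in> fst (B (\<sigma> x))) \<longrightarrow>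
     agree F J A B V \<sigma> s s' \<longrightarrow> sat (lex_sum J A) s \<phi> = sat (lex_sum J B) s' \<phi>"
    by (elim exE conjE)
  then show ?case by (intro exI[of _ F]) simp
next
  case (Conj \<phi> \<psi>)
  obtain F where fF: "finite F" and F: "\<forall>(A :: 'i \<Rightarrow> 'a struct) (B :: 'i \<Rightarrow> 'b struct) V \<sigma> s s'.
     disjoint_structs J A \<longrightarrow> disjoint_structs J B \<longrightarrow> fv \<phi> \<subseteq> V \<longrightarrow>
     (\<forall>x\<in>V. \<sigma> x \<in> fst J \<and> s x \<in> fst (A (\<sigma> x)) \<and> s' x \<in> fst (B (\<sigma> x))) \<longrightarrow>
     agree F J A B V \<sigma> s s' \<longrightarrow> sat (lex_sum J A) s \<phi> = sat (lex_sum J B) s' \<phi>"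
    using Conj.IH(1) by (elim exE conjE)
  obtain G where fG: "finite G" and G: "\<forall>(A :: 'i \<Rightarrow> 'a struct) (B :: 'i \<Rightarrow> 'b struct) V \<sigma> s s'.
     disjoint_structs J A \<longrightarrow> disjoint_structs J B \<longrightarrow> fv \<psi> \<subseteq> V \<longrightarrow>
     (\<forall>x\<in>V. \<sigma> x \<in> fst J \<and> s x \<in> fst (A (\<sigma> x)) \<and> s' x \<in> fst (B (\<sigma> x))) \<longrightarrow>
     agree G J A B V \<sigma> s s' \<longrightarrow> sat (lex_sum J A) s \<psi> = sat (lex_sum J B) s' \<psi>"
    using Conj.IH(2) by (elim exE conjE)
  show ?case
  proof (intro exI[of _ "F \<union> G"] conjI allI impI)
    fix A :: "'i \<Rightarrow> 'a struct" and B :: "'i \<Rightarrow> 'b struct" and V \<sigma> s s'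
    assume A: "disjoint_structs J A" and B: "disjoint_structs J B" and V: "fv (Conj \<phi> \<psi>) \<subseteq> V"
      and s: "\<forall>x\<in>V. \<sigma> x \<in> fst J \<and> s x \<in> fst (A (\<sigma> x)) \<and> s' x \<in> fst (B (\<sigma> x))"
      and ag: "agree (F \<union> G) J A B V \<sigma> s s'"
    have "fv \<phi> \<subseteq> V" "fv \<psi> \<subseteq> V" "agree F J A B V \<sigma> s s'" "agree G J A B V \<sigma> s s'"
      using V ag by (auto intro: agree_mono)
    then show "sat (lex_sum J A) s (Conj \<phi> \<psi>) = sat (lex_sum J B) s' (Conj \<phi> \<psi>)"
      using F[rule_format, OF A B _ s[rule_format]] G[rule_format, OF A B _ s[rule_format]]
      by simp
  qed (simp add: fF fG)
next
  case (Exi n \<phi>)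
  obtain F where fF: "finite F" and F: "\<forall>(A :: 'i \<Rightarrow> 'a struct) (B :: 'i \<Rightarrow> 'b struct) V \<sigma> s s'.
     disjoint_structs J A \<longrightarrow> disjoint_structs J B \<longrightarrow> fv \<phi> \<subseteq> V \<longrightarrow>
     (\<forall>x\<in>V. \<sigma> x \<in> fst J \<and> s x \<in> fst (A (\<sigma> x)) \<and> s' x \<in> fst (B (\<sigma> x))) \<longrightarrow>
     agree F J A B V \<sigma> s s' \<longrightarrow> sat (lex_sum J A) s \<phi> = sat (lex_sum J B) s' \<phi>"
    using Exi.IH by (elim exE conjE)
  show ?case
  proof (intro exI[of _ "refine n F"] conjI allI impI)
    fix A :: "'i \<Rightarrow> 'a struct" and B :: "'i \<Rightarrow> 'b struct" and V \<sigma> s s'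
    assume A: "disjoint_structs J A" and B: "disjoint_structs J B" and V: "fv (Exi n \<phi>) \<subseteq> V"
      and s: "\<forall>x\<in>V. \<sigma> x \<in> fst J \<and> s x \<in> fst (A (\<sigma> x)) \<and> s' x \<in> fst (B (\<sigma> x))"
      and ag: "agree (refine n F) J A B V \<sigma> s s'"
    have st: "is_struct (A i)" "is_struct (B i)" if "i \<in> fst J" for i
      using A B that by (auto simp: disjoint_structs_def)
    have eq: "sat (lex_sum J A) (s(n := a)) \<phi> = sat (lex_sum J B) (s'(n := b)) \<phi>"
      if "i \<in> fst J" "a \<in> fst (A i)" "b \<in> fst (B i)"
        "agree F J A B (insert n V) (\<sigma>(n := i)) (s(n := a)) (s'(n := b))" for i a b
      by (rule F[rule_format, OF A B _ _ that(4)]) (use V s that(1-3) in auto)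
    show "sat (lex_sum J A) s (Exi n \<phi>) = sat (lex_sum J B) s' (Exi n \<phi>)"
    proof
      assume "sat (lex_sum J A) s (Exi n \<phi>)"
      then obtain i a where i: "i \<in> fst J" "a \<in> fst (A i)" "sat (lex_sum J A) (s(n := a)) \<phi>"
        by (auto simp: fst_lex_sum)
      obtain b where "b \<in> fst (B i)"
        "agree F J A B (insert n V) (\<sigma>(n := i)) (s(n := a)) (s'(n := b))"
        using agree_extend[OF fF st[OF i(1)] i(1) ag i(2)] by blast
      then show "sat (lex_sum J B) s' (Exi n \<phi>)"
        using i eq[of i a b] by (auto simp: fst_lex_sum)
    next
      assume "sat (lex_sum J B) s' (Exi n \<phi>)"
      then obtain i b where i: "i \<in> fst J" "b \<in> fst (B i)" "sat (lex_sum J B) (s'(n := b)) \<phi>"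
        by (auto simp: fst_lex_sum)
      obtain a where "a \<in> fst (A i)"
        "agree F J A B (insert n V) (\<sigma>(n := i)) (s(n := a)) (s'(n := b))"
        using agree_extend[OF fF st(2,1)[OF i(1)] i(1) agree_sym[OF ag] i(2)] agree_sym by blast
      then show "sat (lex_sum J A) s (Exi n \<phi>)"
        using i eq[of i a b] by (auto simp: fst_lex_sum)
    qed
  qed (simp add: finite_refine fF)
qed

section \<open>Preservation of elementary equivalence and of finitely many types\<close>

text \<open>The finite set is needed only to run the induction; applications have agreement on all
  formulas at once.\<close>

lemma sat_lex_sum_eq:
  fixes A :: "'i \<Rightarrow> 'a struct" and B :: "'i \<Rightarrow> 'b struct"
  assumes "disjoint_structs J A" "disjoint_structs J B" "fv \<phi> \<subseteq> V"
    and "\<And>x. x \<in> V \<Longrightarrow> \<sigma> x \<in> fst J \<and> s x \<in> fst (A (\<sigma> x)) \<and> s' x \<in> fst (B (\<sigma> x))"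
    and "\<And>i \<psi>. i \<in> fst J \<Longrightarrow> fv \<psi> \<subseteq> {x \<in> V. \<sigma> x = i} \<Longrightarrow> sat (A i) s \<psi> = sat (B i) s' \<psi>"
  shows "sat (lex_sum J A) s \<phi> = sat (lex_sum J B) s' \<phi>"
proof -
  obtain F where F: "\<forall>(A :: 'i \<Rightarrow> 'a struct) (B :: 'i \<Rightarrow> 'b struct) V \<sigma> s s'.
     disjoint_structs J A \<longrightarrow> disjoint_structs J B \<longrightarrow> fv \<phi> \<subseteq> V \<longrightarrow>
     (\<forall>x\<in>V. \<sigma> x \<in> fst J \<and> s x \<in> fst (A (\<sigma> x)) \<and> s' x \<in> fst (B (\<sigma> x))) \<longrightarrow>
     agree F J A B V \<sigma> s s' \<longrightarrow> sat (lex_sum J A) s \<phi> = sat (lex_sum J B) s' \<phi>"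
    using sat_lex_sum_agree[of J \<phi>] by (elim exE conjE)
  have ag: "agree F J A B V \<sigma> s s'" using assms(5) by (simp add: agree_def)
  show ?thesis by (rule F[rule_format, OF assms(1-3) _ ag]) (rule assms(4))
qed

lemma elem_equiv_lex_sum:
  fixes A :: "'i \<Rightarrow> 'a struct" and B :: "'i \<Rightarrow> 'b struct"
  assumes J: "is_struct J" and A: "disjoint_structs J A" and B: "disjoint_structs J B"
    and eq: "\<And>i. i \<in> fst J \<Longrightarrow> elem_equiv (A i) (B i)"
  shows "elem_equiv (lex_sum J A) (lex_sum J B)"
  unfolding elem_equiv_def
proof (intro allI impI)
  fix \<phi> assume \<phi>: "sentence \<phi>"
  obtain s :: "nat \<Rightarrow> 'a" where s: "range s \<subseteq> fst (lex_sum J A)"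
    using ex_valuation[OF is_struct_lex_sum[OF J A]] by blast
  obtain s' :: "nat \<Rightarrow> 'b" where s': "range s' \<subseteq> fst (lex_sum J B)"
    using ex_valuation[OF is_struct_lex_sum[OF J B]] by blast
  \<comment> \<open>With no variables tracked, agreement concerns only sentences. As
    \<open>s\<close> and \<open>s'\<close> may leave the summand, valuations \<open>r\<close> and
    \<open>r'\<close> inside it are used for the comparison.\<close>
  have "sat (A i) s \<psi> = sat (B i) s' \<psi>" if i: "i \<in> fst J" and \<psi>: "fv \<psi> = {}" for i \<psi>
  proof -
    obtain r :: "nat \<Rightarrow> 'a" where r: "range r \<subseteq> fst (A i)"
      using ex_valuation[of "A i"] A i by (auto simp: disjoint_structs_def)
    obtain r' :: "nat \<Rightarrow> 'b" where r': "range r' \<subseteq> fst (B i)"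
      using ex_valuation[of "B i"] B i by (auto simp: disjoint_structs_def)
    have "sat (A i) s \<psi> = sat (A i) r \<psi>" by (rule sat_cong) (simp add: \<psi>)
    moreover have "sat (B i) s' \<psi> = sat (B i) r' \<psi>" by (rule sat_cong) (simp add: \<psi>)
    moreover have "sat (A i) r \<psi> = sat (B i) r' \<psi>"
      using holds_sentence[OF _ r, of \<psi>] holds_sentence[OF _ r', of \<psi>] eq[OF i] \<psi>
      by (simp add: elem_equiv_def sentence_def)
    ultimately show ?thesis by simp
  qed
  then have "sat (lex_sum J A) s \<phi> = sat (lex_sum J B) s' \<phi>"
    using \<phi> by (intro sat_lex_sum_eq[OF A B, of \<phi> "{}"]) (auto simp: sentence_def)
  then show "holds (lex_sum J A) \<phi> = holds (lex_sum J B) \<phi>"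
    by (simp add: holds_sentence[OF \<phi> s] holds_sentence[OF \<phi> s'])
qed

text \<open>The type of a tuple in the sum is determined by the summands in which its entries lie
  and by one complete formula satisfied in each summand. This invariant takes finitely many
  values.\<close>

lemma ryll_nardzewski_lex_sum:
  fixes A :: "'i \<Rightarrow> 'a struct"
  assumes J: "is_struct J" "finite (fst J)" and A: "disjoint_structs J A"
    and RN: "\<And>i. i \<in> fst J \<Longrightarrow> ryll_nardzewski (A i)"
  shows "ryll_nardzewski (lex_sum J A)"
  unfolding ryll_nardzewski_def
proof (intro allI finite_types_imp_complete_fms is_struct_lex_sum J(1) A)
  fix n
  define S where "S = {s :: nat \<Rightarrow> 'a. range s \<subseteq> fst (lex_sum J A)}"
  define tp where "tp s = {\<phi>. fv \<phi> \<subseteq> {..<n} \<and> sat (lex_sum J A) s \<phi>}" for s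
  have "\<forall>i\<in>fst J. \<exists>\<Theta>. finite \<Theta> \<and> (\<forall>\<theta>\<in>\<Theta>. complete_fm (A i) n \<theta>) \<and>
     (\<forall>s. range s \<subseteq> fst (A i) \<longrightarrow> (\<exists>\<theta>\<in>\<Theta>. sat (A i) s \<theta>))"
    using RN unfolding ryll_nardzewski_def by blast
  then obtain \<Theta> where \<Theta>: "\<forall>i\<in>fst J. finite (\<Theta> i) \<and> (\<forall>\<theta>\<in>\<Theta> i. complete_fm (A i) n \<theta>) \<and>
     (\<forall>s. range s \<subseteq> fst (A i) \<longrightarrow> (\<exists>\<theta>\<in>\<Theta> i. sat (A i) s \<theta>))"
    unfolding bchoice_iff by (elim exE)
  define d where "d i = (SOME x. x \<in> fst (A i))" for i
  have d: "d i \<in> fst (A i)" if "i \<in> fst J" for i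
    unfolding d_def using A that
    by (auto simp: disjoint_structs_def is_struct_def intro: some_in_eq[THEN iffD2])
  \<comment> \<open>Entries outside summand \<open>i\<close> are replaced by a default element, so
    that the complete formulas of \<open>A i\<close> can be evaluated there.\<close>
  define r where "r s i x = (if s x \<in> fst (A i) then s x else d i)" for s i and x :: nat
  have r: "range (r s i) \<subseteq> fst (A i)" if "i \<in> fst J" for s i
    using d[OF that] by (auto simp: r_def)
  define invt where "invt s = ({(x, i). x < n \<and> i \<in> fst J \<and> s x \<in> fst (A i)},
      {(i, \<theta>). i \<in> fst J \<and> \<theta> \<in> \<Theta> i \<and> sat (A i) (r s i) \<theta>})" for s
  have "finite (Pow ({..<n} \<times> fst J) \<times> Pow (Sigma (fst J) \<Theta>))" using \<Theta> J(2) by auto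
  moreover have "invt ` S \<subseteq> Pow ({..<n} \<times> fst J) \<times> Pow (Sigma (fst J) \<Theta>)"
    by (auto simp: invt_def)
  ultimately have fin: "finite (invt ` S)" by (rule finite_subset[rotated])
  have key: "sat (lex_sum J A) s \<phi> = sat (lex_sum J A) s' \<phi>"
    if s: "s \<in> S" and e: "invt s = invt s'" and \<phi>: "fv \<phi> \<subseteq> {..<n}" for s s' \<phi>
  proof -
    have "\<forall>x. \<exists>i. i \<in> fst J \<and> s x \<in> fst (A i)"
      using s unfolding S_def fst_lex_sum by blast
    then obtain \<sigma> where \<sigma>: "\<And>x. \<sigma> x \<in> fst J" "\<And>x. s x \<in> fst (A (\<sigma> x))" by metis
    have e1: "(x, i) \<in> fst (invt s) \<longleftrightarrow> (x, i) \<in> fst (invt s')" for x i using e by simp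
    have e2: "(i, \<theta>) \<in> snd (invt s) \<longleftrightarrow> (i, \<theta>) \<in> snd (invt s')" for i \<theta> using e by simp
    have \<sigma>': "s' x \<in> fst (A (\<sigma> x))" if "x < n" for x
      using e1[of x "\<sigma> x"] \<sigma> that by (simp add: invt_def)
    show ?thesis
    proof (rule sat_lex_sum_eq[OF A A \<phi>])
      show "\<sigma> x \<in> fst J \<and> s x \<in> fst (A (\<sigma> x)) \<and> s' x \<in> fst (A (\<sigma> x))" if "x \<in> {..<n}" for x
        using \<sigma> \<sigma>' that by auto
      fix i \<psi> assume i: "i \<in> fst J" and \<psi>: "fv \<psi> \<subseteq> {x \<in> {..<n}. \<sigma> x = i}"
      have 1: "sat (A i) s \<psi> = sat (A i) (r s i) \<psi>"
        by (rule sat_cong) (use \<psi> \<sigma>(2) in \<open>auto simp: r_def\<close>)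
      have 2: "sat (A i) s' \<psi> = sat (A i) (r s' i) \<psi>"
        by (rule sat_cong) (use \<psi> \<sigma>' in \<open>auto simp: r_def\<close>)
      obtain \<theta> where \<theta>: "\<theta> \<in> \<Theta> i" "sat (A i) (r s i) \<theta>" using \<Theta> i r[OF i] by blast
      have \<theta>': "sat (A i) (r s' i) \<theta>" using e2[of i \<theta>] i \<theta> by (simp add: invt_def)
      have "fm_implies (A i) \<theta> \<psi> \<or> fm_implies (A i) \<theta> (Neg \<psi>)"
        using \<Theta> i \<theta>(1) \<psi> unfolding complete_fm_def by blast
      then show "sat (A i) s \<psi> = sat (A i) s' \<psi>"
        unfolding 1 2 using \<theta>(2) \<theta>' r[OF i] by (auto simp: fm_implies_def)
    qed
  qed
  \<comment> \<open>A chosen valuation with the same invariant has the same type, so there are no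
    more types than invariants.\<close>
  have "tp s = tp (inv_into S invt (invt s))" if "s \<in> S" for s
  proof -
    have "invt (inv_into S invt (invt s)) = invt s"
      by (rule f_inv_into_f[of "invt s" invt S]) (use that in blast)
    from this[symmetric] show ?thesis unfolding tp_def using key[OF that] by blast
  qed
  then have "tp ` S \<subseteq> (\<lambda>y. tp (inv_into S invt y)) ` (invt ` S)" by blast
  then have "finite (tp ` S)" by (rule finite_subset) (simp add: fin)
  then show "finite ((\<lambda>s. {\<phi>. fv \<phi> \<subseteq> {..<n} \<and> sat (lex_sum J A) s \<phi>}) `
      {s. range s \<subseteq> fst (lex_sum J A)})"
    by (simp add: tp_def[abs_def] S_def)
qed

section \<open>Counting countable models\<close>

lemma isomorphic_refl: "isomorphic M M"
  unfolding isomorphic_def by (intro exI[of _ id]) simp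

lemma isomorphic_sym:
  assumes "isomorphic M N"
  shows "isomorphic N M"
proof -
  obtain f where f: "bij_betw f (fst M) (fst N)"
    "\<forall>x\<in>fst M. \<forall>y\<in>fst M. (x, y) \<in> snd M \<longleftrightarrow> (f x, f y) \<in> snd N"
    using assms unfolding isomorphic_def by blast
  define g where "g = inv_into (fst M) f"
  have g: "bij_betw g (fst N) (fst M)" unfolding g_def by (rule bij_betw_inv_into[OF f(1)])
  have "(x, y) \<in> snd N \<longleftrightarrow> (g x, g y) \<in> snd M" if "x \<in> fst N" "y \<in> fst N" for x y
  proof -
    have "g x \<in> fst M" "g y \<in> fst M" using g that by (auto dest: bij_betwE)
    moreover have "f (g x) = x" "f (g y) = y"
      using that f(1) by (simp_all add: g_def bij_betw_inv_into_right)
    ultimately show ?thesis using f(2) by metis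
  qed
  then show ?thesis using g unfolding isomorphic_def by blast
qed

lemma isomorphic_trans:
  assumes "isomorphic M N" "isomorphic N K"
  shows "isomorphic M K"
proof -
  obtain f where f: "bij_betw f (fst M) (fst N)"
    "\<forall>x\<in>fst M. \<forall>y\<in>fst M. (x, y) \<in> snd M \<longleftrightarrow> (f x, f y) \<in> snd N"
    using assms(1) unfolding isomorphic_def by blast
  obtain g where g: "bij_betw g (fst N) (fst K)"
    "\<forall>x\<in>fst N. \<forall>y\<in>fst N. (x, y) \<in> snd N \<longleftrightarrow> (g x, g y) \<in> snd K"
    using assms(2) unfolding isomorphic_def by blast
  have "f x \<in> fst N" if "x \<in> fst M" for x using f(1) that by (auto dest: bij_betwE)
  then have "\<forall>x\<in>fst M. \<forall>y\<in>fst M. (x, y) \<in> snd M \<longleftrightarrow> ((g \<circ> f) x, (g \<circ> f) y) \<in> snd K"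
    using f(2) g(2) by simp
  then show ?thesis using bij_betw_trans[OF f(1) g(1)] unfolding isomorphic_def by blast
qed

lemma isomorphic_elem_equiv:
  fixes M :: "'a struct" and N :: "'b struct"
  assumes "is_struct M" "isomorphic M N"
  shows "elem_equiv M N"
  unfolding elem_equiv_def
proof (intro allI impI)
  fix \<phi> assume \<phi>: "sentence \<phi>"
  obtain f where f: "bij_betw f (fst M) (fst N)"
    "\<And>x y. x \<in> fst M \<Longrightarrow> y \<in> fst M \<Longrightarrow> (x, y) \<in> snd M \<longleftrightarrow> (f x, f y) \<in> snd N"
    using assms(2) unfolding isomorphic_def by blast
  obtain s :: "nat \<Rightarrow> 'a" where s: "range s \<subseteq> fst M" using ex_valuation[OF assms(1)] by blast
  have s': "range (f \<circ> s) \<subseteq> fst N"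
    using s bij_betw_imp_surj_on[OF f(1)] by auto
  show "holds M \<phi> = holds N \<phi>"
    using isomorphic_sat[OF f s] by (simp only: holds_sentence[OF \<phi> s] holds_sentence[OF \<phi> s'])
qed

definition image_struct :: "('a \<Rightarrow> 'b) \<Rightarrow> 'a struct \<Rightarrow> 'b struct" where
  "image_struct f M = (f ` fst M, map_prod f f ` snd M)"

lemma is_struct_image_struct: "is_struct M \<Longrightarrow> is_struct (image_struct f M)"
  by (auto simp: is_struct_def image_struct_def)

lemma isomorphic_image_struct:
  assumes "is_struct M" "inj f"
  shows "isomorphic M (image_struct f M)"
proof -
  have "inj (map_prod f f)" using assms(2) prod.inj_map by blast
  then have "(f x, f y) \<in> map_prod f f ` snd M \<longleftrightarrow> (x, y) \<in> snd M" for x y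
    using inj_image_mem_iff[of "map_prod f f" "(x, y)" "snd M"] by simp
  moreover have "bij_betw f (fst M) (f ` fst M)"
    by (rule inj_on_imp_bij_betw[OF inj_on_subset[OF assms(2) subset_UNIV]])
  ultimately show ?thesis
    unfolding isomorphic_def image_struct_def by (intro exI[of _ f]) simp
qed

section \<open>Models of a complete theory\<close>

lemma models_Th:
  fixes M :: "'a struct"
  assumes M: "is_struct M"
  shows "models (Th M) = {N :: 'b struct. is_struct N \<and> elem_equiv M N}"
proof (intro set_eqI iffI)
  fix N :: "'b struct" assume N: "N \<in> models (Th M)"
  then have st: "is_struct N" and *: "\<And>\<phi>. sentence \<phi> \<Longrightarrow> holds M \<phi> \<Longrightarrow> holds N \<phi>"
    by (auto simp: models_def Th_def)
  obtain s :: "nat \<Rightarrow> 'a" where s: "range s \<subseteq> fst M" using ex_valuation[OF M] by blast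
  obtain r :: "nat \<Rightarrow> 'b" where r: "range r \<subseteq> fst N" using ex_valuation[OF st] by blast
  have "holds M \<phi> = holds N \<phi>" if "sentence \<phi>" for \<phi>
  proof -
    have n: "sentence (Neg \<phi>)" using that by (simp add: sentence_def)
    show ?thesis
      using *[OF that] *[OF n] holds_sentence[OF that s] holds_sentence[OF n s]
        holds_sentence[OF that r] holds_sentence[OF n r] by auto
  qed
  with st show "N \<in> {N. is_struct N \<and> elem_equiv M N}" by (simp add: elem_equiv_def)
qed (auto simp: models_def Th_def elem_equiv_def)

text \<open>Completeness is stated for models over \<open>nat\<close>, whereas \<open>M\<close> may
  live in any type. A countable structure \<open>N0\<close> elementarily equivalent to
  \<open>M\<close> links the two.\<close>

lemma models_complete_theory:
  fixes M :: "'a struct"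
  assumes T: "complete_theory T" and M: "M \<in> models T"
  shows "models T = {N :: nat struct. is_struct N \<and> elem_equiv M N}"
proof -
  have stM: "is_struct M" using M by (simp add: models_def)
  have sen: "\<And>\<phi>. \<phi> \<in> T \<Longrightarrow> sentence \<phi>" using T by (simp add: complete_theory_def)
  have sub: "N \<in> models T" if "is_struct N" "elem_equiv M N" for N :: "nat struct"
    using that M sen by (auto simp: models_def elem_equiv_def)
  obtain N0 :: "nat struct" where N0: "is_struct N0" "elem_equiv M N0"
    using ex_countable_elem_equiv[OF stM] by blast
  have "elem_equiv N0 N" if N: "N \<in> models T" for N :: "nat struct"
  proof -
    have "N \<in> models (Th N0)"
      unfolding models_def
    proof (intro CollectI conjI ballI)
      show stN: "is_struct N" using N by (simp add: models_def)
      fix \<phi> assume "\<phi> \<in> Th N0"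
      then have \<phi>: "sentence \<phi>" "holds N0 \<phi>" by (auto simp: Th_def)
      obtain s :: "nat \<Rightarrow> nat" where s: "range s \<subseteq> fst N0" using ex_valuation[OF N0(1)] by blast
      have "\<not> holds N0 (Neg \<phi>)" using \<phi>(2) s by (auto simp: holds_def)
      then have "\<not> entails T (Neg \<phi>)" using sub[OF N0] by (auto simp: entails_def)
      then have "entails T \<phi>" using T \<phi>(1) by (auto simp: complete_theory_def)
      then show "holds N \<phi>" using N by (auto simp: entails_def)
    qed
    then show ?thesis using models_Th[OF N0(1)] by blast
  qed
  then have "elem_equiv M N" if "N \<in> models T" for N :: "nat struct"
    using that elem_equiv_trans[OF N0(2)] by blast
  moreover have "is_struct N" if "N \<in> models T" for N :: "nat struct"
    using that by (simp add: models_def)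
  ultimately show ?thesis using sub by blast
qed

lemma elem_equiv_has_largest:
  fixes M :: "'a struct" and N :: "'b struct"
  assumes "is_struct M" "is_struct N" "elem_equiv M N" "has_largest M"
  shows "has_largest N"
proof -
  define \<phi> where "\<phi> = Exi 0 (Neg (Exi 1 (Neg (Le 1 0))))"
  have \<phi>: "sentence \<phi>" by (simp add: \<phi>_def sentence_def)
  have M: "holds M \<phi>" using assms(4) by (auto simp: holds_def \<phi>_def has_largest_def)
  obtain s :: "nat \<Rightarrow> 'b" where s: "range s \<subseteq> fst N" using ex_valuation[OF assms(2)] by blast
  have "holds N \<phi>" using M \<phi> assms(3) by (simp add: elem_equiv_def)
  then have "sat N s \<phi>" using s by (simp add: holds_def)
  then show ?thesis by (auto simp: \<phi>_def has_largest_def)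
qed

section \<open>Cardinalities of sets of isomorphism classes\<close>

abbreviation iso_rel :: "fm set \<Rightarrow> nat struct rel" where
  "iso_rel T \<equiv> {(M, N). M \<in> models T \<and> N \<in> models T \<and> isomorphic M N}"

lemma equiv_iso_rel: "equiv (models T) (iso_rel T)"
proof (rule equivI)
  show "iso_rel T \<subseteq> models T \<times> models T" by blast
  show "refl_on (models T) (iso_rel T)" by (auto simp: refl_on_def isomorphic_refl)
  show "sym (iso_rel T)" unfolding sym_def using isomorphic_sym by blast
  show "trans (iso_rel T)" unfolding trans_def using isomorphic_trans by blast
qed

lemma num_countable_models_oneI:
  assumes "models T \<noteq> ({} :: nat struct set)"
    and "\<And>(M :: nat struct) (N :: nat struct). M \<in> models T \<Longrightarrow> N \<in> models T \<Longrightarrow> isomorphic M N"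
  shows "num_countable_models T =o cone"
proof -
  have "iso_rel T `` {M} = models T" if "M \<in> models T" for M
    using assms(2)[OF that] that by blast
  then have "models T // iso_rel T = {models T}"
    using assms(1) unfolding quotient_def by blast
  moreover have "|{models T :: nat struct set}| =o |{()}|"
    by (rule card_of_ordIsoI[of "\<lambda>_. ()"]) (simp add: bij_betw_def)
  ultimately show ?thesis by (simp add: num_countable_models_def cone_def)
qed

lemma num_countable_models_oneD:
  fixes M N :: "nat struct"
  assumes "num_countable_models T =o cone" "M \<in> models T" "N \<in> models T"
  shows "isomorphic M N"
proof -
  obtain f where f: "bij_betw f (models T // iso_rel T) {()}"
    using assms(1) unfolding num_countable_models_def cone_def card_of_ordIso[symmetric] by blast
  have "iso_rel T `` {M} \<in> models T // iso_rel T" "iso_rel T `` {N} \<in> models T // iso_rel T"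
    by (rule quotientI[OF assms(2)], rule quotientI[OF assms(3)])
  then have "iso_rel T `` {M} = iso_rel T `` {N}"
    using inj_onD[OF bij_betw_imp_inj_on[OF f]] by simp
  then have "(M, N) \<in> iso_rel T"
    using eq_equiv_class[OF _ equiv_iso_rel assms(3)] by blast
  then show ?thesis by simp
qed

lemma continuum_ordIso: "ctwo ^c natLeq =o |UNIV :: nat set set|"
proof -
  have "|Pow (UNIV :: nat set)| =o |Func (UNIV :: nat set) (UNIV :: bool set)|"
    by (rule card_of_Pow_Func)
  then show ?thesis
    unfolding cexp_def ctwo_def Field_card_of Field_natLeq Pow_UNIV by (rule ordIso_symmetric)
qed

text \<open>The disjoint sum of domain and order of a structure over \<open>nat\<close> is coded
  injectively by a set of naturals.\<close>

lemma num_countable_models_le_continuum: "num_countable_models T \<le>o |UNIV :: nat set set|"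
proof -
  have "models T // iso_rel T = (\<lambda>M. iso_rel T `` {M}) ` models T"
    unfolding quotient_def by auto
  then have "num_countable_models T \<le>o |models T :: nat struct set|"
    unfolding num_countable_models_def by (simp add: card_of_image)
  moreover have "|models T :: nat struct set| \<le>o |UNIV :: nat set set|"
  proof -
    define f :: "nat struct \<Rightarrow> nat set" where "f M = to_nat ` (fst M <+> snd M)" for M
    have "inj f"
    proof (rule injI)
      fix M N assume "f M = f N"
      then have "fst M <+> snd M = fst N <+> snd N"
        unfolding f_def by (simp add: inj_image_eq_iff)
      then have "Inl x \<in> fst M <+> snd M \<longleftrightarrow> Inl x \<in> fst N <+> snd N"
        "Inr y \<in> fst M <+> snd M \<longleftrightarrow> Inr y \<in> fst N <+> snd N" for x y by auto
      then show "M = N" by (auto intro!: prod_eqI)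
    qed
    then show ?thesis
      by (intro card_of_ordLeq[THEN iffD1] exI[of _ f]) (auto intro: inj_on_subset)
  qed
  ultimately show ?thesis by (rule ordLeq_transitive)
qed

text \<open>A countable \<open>Q\<close> would contradict Cantor's theorem, and an infinite
  \<open>Q\<close> absorbs the countable factor.\<close>

lemma continuum_le_if_le_times_nat:
  assumes "|UNIV :: nat set set| \<le>o |Q \<times> (UNIV :: nat set)|"
  shows "|UNIV :: nat set set| \<le>o |Q|"
proof (cases "countable Q")
  case True
  then have "countable (Q \<times> (UNIV :: nat set))" by simp
  moreover obtain f :: "nat set \<Rightarrow> _" where "inj f" "range f \<subseteq> Q \<times> (UNIV :: nat set)"
    using assms unfolding card_of_ordLeq[symmetric] by blast
  ultimately have "countable (range f)" using countable_subset by blast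
  then have "countable (UNIV :: nat set set)" using \<open>inj f\<close> by (rule countable_image_inj_on)
  then have "surj (from_nat_into (UNIV :: nat set set))"
    by (intro range_from_nat_into) auto
  then show ?thesis using Cantors_theorem[of "UNIV :: nat set"] unfolding Pow_UNIV by blast
next
  case False
  then have inf: "infinite Q" using countable_finite by blast
  then have "|UNIV :: nat set| \<le>o |Q|" by (simp add: infinite_iff_card_of_nat)
  then have "|Q \<times> (UNIV :: nat set)| =o |Q|" using card_of_Times_infinite[OF inf] by blast
  then show ?thesis by (rule ordLeq_ordIso_trans[OF assms])
qed

section \<open>Recovering summands from their largest elements\<close>

text \<open>
  If \<open>m j\<close> is the largest element of the summand with index \<open>j\<close>, this is the summand with index
  \<open>i\<close>. A countable structure thus has only countably many decompositions over \<open>J\<close>.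
\<close>

definition component :: "'a struct \<Rightarrow> 'i struct \<Rightarrow> ('i \<Rightarrow> 'a) \<Rightarrow> 'i \<Rightarrow> 'a set" where
  "component W J m i = {x \<in> fst W. (x, m i) \<in> snd W \<and>
     (\<forall>j\<in>fst J. j \<noteq> i \<and> (j, i) \<in> snd J \<longrightarrow> (x, m j) \<notin> snd W)}"

lemma component_cong:
  assumes "i \<in> fst J" "\<And>j. j \<in> fst J \<Longrightarrow> m j = m' j"
  shows "component W J m i = component W J m' i"
  using assms by (simp add: component_def)

text \<open>An element of summand \<open>k\<close> lies below \<open>m j\<close> exactly when
  \<open>k = j\<close> or \<open>k\<close> is below \<open>j\<close>. Excluding all
  \<open>m j\<close> with \<open>j\<close> strictly below \<open>i\<close> therefore leaves only
  \<open>k = i\<close>; antisymmetry ensures that summand \<open>i\<close> itself survives.\<close>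

lemma component_lex_sum:
  assumes A: "disjoint_structs J A" and J: "antisym (snd J)" and i: "i \<in> fst J"
    and m: "\<And>j. j \<in> fst J \<Longrightarrow> m j \<in> fst (A j)"
    and largest: "\<And>j x. j \<in> fst J \<Longrightarrow> x \<in> fst (A j) \<Longrightarrow> (x, m j) \<in> snd (A j)"
  shows "component (lex_sum J A) J m i = fst (A i)"
proof -
  have le: "(x, m j) \<in> snd (lex_sum J A) \<longleftrightarrow> k = j \<or> (k, j) \<in> snd J"
    if "k \<in> fst J" "j \<in> fst J" "x \<in> fst (A k)" for x j k
    using snd_lex_sum_iff[OF A that(1,2,3) m[OF that(2)]] largest[of j x] that by auto
  have "x \<in> component (lex_sum J A) J m i \<longleftrightarrow> k = i" if k: "k \<in> fst J" "x \<in> fst (A k)" for x k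
  proof
    assume x: "x \<in> component (lex_sum J A) J m i"
    then have "k = i \<or> (k, i) \<in> snd J" using le[OF k(1) i k(2)] by (simp add: component_def)
    moreover have "(k, i) \<notin> snd J" if "k \<noteq> i"
      using x that k(1) le[OF k(1) k(1) k(2)] by (auto simp: component_def)
    ultimately show "k = i" by blast
  next
    assume "k = i"
    then have x: "x \<in> fst (A i)" using k by simp
    have "(x, m j) \<notin> snd (lex_sum J A)" if "j \<in> fst J" "j \<noteq> i" "(j, i) \<in> snd J" for j
      using le[OF i that(1) x] that antisymD[OF J that(3)] by blast
    then show "x \<in> component (lex_sum J A) J m i"
      using le[OF i i x] x i by (auto simp: component_def fst_lex_sum)
  qed
  moreover have "x \<in> fst (A i) \<longleftrightarrow> k = i" if k: "k \<in> fst J" "x \<in> fst (A k)" for x k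
    using disjoint_structsD[OF A k(1) i k(2)] k by blast
  moreover have "component (lex_sum J A) J m i \<subseteq> (\<Union>k\<in>fst J. fst (A k))"
    by (auto simp: component_def fst_lex_sum)
  ultimately show ?thesis using i by blast
qed

lemma induced_lex_sum:
  assumes A: "disjoint_structs J A" and i: "i \<in> fst J"
  shows "induced (lex_sum J A) (fst (A i)) = A i"
proof (rule prod_eqI)
  have "snd (A i) \<subseteq> fst (A i) \<times> fst (A i)"
    using A i by (simp add: disjoint_structs_def is_struct_def)
  moreover have "(x, y) \<in> snd (lex_sum J A) \<longleftrightarrow> (x, y) \<in> snd (A i)"
    if "x \<in> fst (A i)" "y \<in> fst (A i)" for x y
    using snd_lex_sum_iff[OF A i i that] by simp
  ultimately show "snd (induced (lex_sum J A) (fst (A i))) = snd (A i)"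
    unfolding induced_def by auto
qed (simp add: induced_def)

text \<open>A component is defined from the order and the parameters \<open>m\<close> alone, so an
  isomorphism carries it to the component of the image parameters.\<close>

lemma isomorphic_component:
  assumes f: "bij_betw f (fst W) (fst W')"
      "\<And>x y. x \<in> fst W \<Longrightarrow> y \<in> fst W \<Longrightarrow> (x, y) \<in> snd W \<longleftrightarrow> (f x, f y) \<in> snd W'"
    and m: "\<And>j. j \<in> fst J \<Longrightarrow> m j \<in> fst W" and i: "i \<in> fst J"
  shows "isomorphic (induced W (component W J m i))
    (induced W' (component W' J (\<lambda>j. f (m j)) i))"
proof -
  define B where "B = component W J m i"
  have B: "B \<subseteq> fst W" by (auto simp: B_def component_def)
  have mem: "f x \<in> component W' J (\<lambda>j. f (m j)) i \<longleftrightarrow> x \<in> B" if x: "x \<in> fst W" for x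
    using bij_betwE[OF f(1)] f(2)[OF x m] x i by (simp add: B_def component_def)
  have "component W' J (\<lambda>j. f (m j)) i \<subseteq> f ` fst W"
    using bij_betw_imp_surj_on[OF f(1)] by (auto simp: component_def)
  then have "f ` B = component W' J (\<lambda>j. f (m j)) i" using mem B by blast
  then have "bij_betw f B (component W' J (\<lambda>j. f (m j)) i)"
    using bij_betw_subset[OF f(1) B] by simp
  moreover have "(x, y) \<in> snd (induced W B) \<longleftrightarrow>
      (f x, f y) \<in> snd (induced W' (component W' J (\<lambda>j. f (m j)) i))" if "x \<in> B" "y \<in> B" for x y
    using that B f(2)[of x y] mem[of x] mem[of y] by (auto simp: induced_def)
  ultimately show ?thesis
    unfolding isomorphic_def B_def[symmetric]
    by (intro exI[of _ f]) (simp add: induced_def)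
qed

text \<open>A list of naturals records the images of the largest elements in \<open>W\<close>. Lists
  are countable in number, which bounds how many summands one \<open>W\<close> can exhibit.\<close>

lemma ex_list_isomorphic_component:
  fixes J :: "nat struct" and W :: "nat struct"
  assumes A: "disjoint_structs J A" and J: "antisym (snd J)" "finite (fst J)" and i: "i \<in> fst J"
    and largest: "\<And>j. j \<in> fst J \<Longrightarrow> has_largest (A j)"
    and W: "isomorphic (lex_sum J A) W"
  shows "\<exists>l. isomorphic (A i) (induced W (component W J ((!) l) i))"
proof -
  obtain f where f: "bij_betw f (fst (lex_sum J A)) (fst W)"
    "\<And>x y. x \<in> fst (lex_sum J A) \<Longrightarrow> y \<in> fst (lex_sum J A) \<Longrightarrow>
      (x, y) \<in> snd (lex_sum J A) \<longleftrightarrow> (f x, f y) \<in> snd W"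
    using W unfolding isomorphic_def by blast
  have "\<forall>j\<in>fst J. \<exists>m. m \<in> fst (A j) \<and> (\<forall>x\<in>fst (A j). (x, m) \<in> snd (A j))"
    using largest unfolding has_largest_def by blast
  then obtain m where m: "\<forall>j\<in>fst J. m j \<in> fst (A j) \<and> (\<forall>x\<in>fst (A j). (x, m j) \<in> snd (A j))"
    unfolding bchoice_iff by (elim exE)
  have mW: "m j \<in> fst (lex_sum J A)" if "j \<in> fst J" for j
    using m that by (auto simp: fst_lex_sum)
  have comp: "component (lex_sum J A) J m i = fst (A i)"
    by (rule component_lex_sum[OF A J(1) i]) (use m in auto)
  obtain k where k: "\<And>j. j \<in> fst J \<Longrightarrow> j < k"
    using J(2) finite_nat_iff_bounded[of "fst J"] by auto
  \<comment> \<open>Entries at positions outside \<open>fst J\<close> are arbitrary;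
    \<open>component\<close> reads only indices in \<open>J\<close>.\<close>
  define l where "l = map (\<lambda>j. f (m j)) [0..<k]"
  have "component W J (\<lambda>j. f (m j)) i = component W J ((!) l) i"
    by (rule component_cong[OF i]) (simp add: l_def k)
  moreover have "isomorphic (induced (lex_sum J A) (component (lex_sum J A) J m i))
      (induced W (component W J (\<lambda>j. f (m j)) i))"
    by (rule isomorphic_component[OF f _ i]) (simp_all add: mW)
  ultimately show ?thesis by (auto simp: comp induced_lex_sum[OF A i])
qed

text \<open>Sending a model of the theory of \<open>A i\<close> to the sum containing it is
  countable-to-one on isomorphism classes, since the summand can be read off from the sum and a list
  of parameters.\<close>

lemma continuum_models_lex_sum:
  fixes J :: "nat struct" and A :: "nat \<Rightarrow> 'a struct"
  assumes J: "is_struct J" "antisym (snd J)" "finite (fst J)" and A: "disjoint_structs J A"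
    and largest: "\<And>j. j \<in> fst J \<Longrightarrow> has_largest (A j)"
    and i: "i \<in> fst J" and cont: "num_countable_models (Th (A i)) =o ctwo ^c natLeq"
    and T: "models T = {N :: nat struct. is_struct N \<and> elem_equiv (lex_sum J A) N}"
  shows "num_countable_models T =o ctwo ^c natLeq"
proof -
  have stA: "is_struct (A j)" if "j \<in> fst J" for j using A that by (simp add: disjoint_structs_def)
  have "\<forall>j\<in>fst J. \<exists>N :: nat struct. is_struct N \<and> elem_equiv (A j) N"
    using ex_countable_elem_equiv[OF stA] by blast
  then obtain Y :: "nat \<Rightarrow> nat struct" where Y: "\<forall>j\<in>fst J. is_struct (Y j) \<and> elem_equiv (A j) (Y j)"
    unfolding bchoice_iff by (elim exE)
  \<comment> \<open>Tagging each element with its index by \<open>prod_encode\<close> makes the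
    summands disjoint while staying inside \<open>nat\<close>.\<close>
  define B :: "nat struct \<Rightarrow> nat \<Rightarrow> nat struct"
    where "B N j = image_struct (\<lambda>x. prod_encode (j, x)) (if j = i then N else Y j)" for N j
  define U where "U = (models (Th (A i)) :: nat struct set)"
  have U: "U = {N. is_struct N \<and> elem_equiv (A i) N}" unfolding U_def by (rule models_Th[OF stA[OF i]])
  have inj: "inj (\<lambda>x. prod_encode (j, x))" for j by (auto intro: injI)
  have BY: "is_struct (B N j) \<and> elem_equiv (A j) (B N j)" if N: "N \<in> U" and j: "j \<in> fst J" for N j
  proof -
    define K where "K = (if j = i then N else Y j)"
    have K: "is_struct K" "elem_equiv (A j) K" using N j Y by (auto simp: K_def U)
    have "elem_equiv K (image_struct (\<lambda>x. prod_encode (j, x)) K)"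
      by (rule isomorphic_elem_equiv[OF K(1) isomorphic_image_struct[OF K(1) inj]])
    then show ?thesis unfolding B_def K_def[symmetric]
      using is_struct_image_struct[OF K(1)] elem_equiv_trans[OF K(2)] by blast
  qed
  have disj: "disjoint_structs J (B N)" if "N \<in> U" for N
    using BY[OF that] unfolding disjoint_structs_def by (auto simp: B_def image_struct_def)
  have B_largest: "has_largest (B N j)" if "N \<in> U" "j \<in> fst J" for N j
    using elem_equiv_has_largest[OF stA[OF that(2)] _ _ largest[OF that(2)]] BY[OF that] by blast
  have sum: "lex_sum J (B N) \<in> models T" if "N \<in> U" for N
    unfolding T using is_struct_lex_sum[OF J(1) disj[OF that]]
      elem_equiv_lex_sum[OF J(1) A disj[OF that]] BY[OF that] by blast
  have iso_B: "isomorphic N (B N i)" if "N \<in> U" for N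
    using isomorphic_image_struct[OF _ inj] that by (simp add: B_def U)
  define S where "S = U // iso_rel (Th (A i))"
  define Q where "Q = models T // iso_rel T"
  define rep where "rep C = (SOME N. N \<in> C)" for C :: "nat struct set"
  have rep: "rep C \<in> U" "C = iso_rel (Th (A i)) `` {rep C}" if C: "C \<in> S" for C
  proof -
    obtain N where N: "N \<in> U" "C = iso_rel (Th (A i)) `` {N}"
      using C unfolding S_def by (rule quotientE)
    then have "N \<in> C" by (auto simp: U_def isomorphic_refl)
    then have "rep C \<in> C" unfolding rep_def by (rule someI)
    with N have r: "(N, rep C) \<in> iso_rel (Th (A i))" by blast
    then show "rep C \<in> U" by (simp add: U_def)
    show "C = iso_rel (Th (A i)) `` {rep C}"
      by (rule trans[OF N(2) equiv_class_eq[OF equiv_iso_rel r]])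
  qed
  \<comment> \<open>The class of the sum in which a representative of \<open>C\<close> takes the
    place of summand \<open>i\<close>.\<close>
  define g where "g C = iso_rel T `` {lex_sum J (B (rep C))}" for C
  define W where "W D = (SOME N. N \<in> D)" for D :: "nat struct set"
  have W: "isomorphic (lex_sum J (B (rep C))) (W (g C))" if "C \<in> S" for C
  proof -
    have "lex_sum J (B (rep C)) \<in> g C"
      using sum[OF rep(1)[OF that]] by (simp add: g_def isomorphic_refl)
    then have "W (g C) \<in> g C" unfolding W_def by (rule someI)
    moreover have "isomorphic (lex_sum J (B (rep C))) N" if "N \<in> g C" for N
      using that by (simp add: g_def)
    ultimately show ?thesis by blast
  qed
  \<comment> \<open>The candidate for summand \<open>i\<close> that the parameter list
    \<open>l\<close> cuts out of the chosen member of \<open>D\<close>.\<close>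
  define part where "part D l = induced (W D) (component (W D) J ((!) l) i)" for D and l :: "nat list"
  have "\<exists>l. isomorphic (rep C) (part (g C) l)" if C: "C \<in> S" for C
  proof -
    note U' = rep(1)[OF C]
    obtain l where "isomorphic (B (rep C) i) (part (g C) l)"
      using ex_list_isomorphic_component[OF disj[OF U'] J(2,3) i B_largest[OF U'] W[OF C]]
      unfolding part_def by blast
    then show ?thesis using isomorphic_trans[OF iso_B[OF U']] by blast
  qed
  then obtain l where l: "\<And>C. C \<in> S \<Longrightarrow> isomorphic (rep C) (part (g C) (l C))" by metis
  \<comment> \<open>Equal sum classes and equal lists give the same \<open>part\<close>, to which
    both representatives are isomorphic.\<close>
  have "inj_on (\<lambda>C. (g C, to_nat (l C))) S"
  proof (rule inj_onI)
    fix C C' assume C: "C \<in> S" "C' \<in> S" and eq: "(g C, to_nat (l C)) = (g C', to_nat (l C'))"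
    have "isomorphic (rep C) (rep C')"
      using l[OF C(1)] l[OF C(2)] eq by (auto intro: isomorphic_trans isomorphic_sym)
    then have "(rep C, rep C') \<in> iso_rel (Th (A i))"
      using rep(1)[OF C(1)] rep(1)[OF C(2)] by (simp add: U_def)
    then have "iso_rel (Th (A i)) `` {rep C} = iso_rel (Th (A i)) `` {rep C'}"
      by (rule equiv_class_eq[OF equiv_iso_rel])
    from trans[OF rep(2)[OF C(1)] trans[OF this rep(2)[OF C(2), symmetric]]] show "C = C'" .
  qed
  moreover have "g C \<in> Q" if "C \<in> S" for C
    unfolding Q_def g_def by (rule quotientI[OF sum[OF rep(1)[OF that]]])
  then have "(\<lambda>C. (g C, to_nat (l C))) ` S \<subseteq> Q \<times> UNIV" by blast
  ultimately have le: "|S| \<le>o |Q \<times> (UNIV :: nat set)|" unfolding card_of_ordLeq[symmetric] by blast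
  have "|UNIV :: nat set set| =o |S|"
    using ordIso_symmetric[OF ordIso_transitive[OF cont continuum_ordIso]]
    unfolding num_countable_models_def S_def U_def .
  then have "|UNIV :: nat set set| \<le>o |Q|"
    by (rule continuum_le_if_le_times_nat[OF ordIso_ordLeq_trans[OF _ le]])
  moreover have "|Q| \<le>o |UNIV :: nat set set|"
    using num_countable_models_le_continuum[of T] unfolding num_countable_models_def Q_def .
  ultimately have "|Q| =o |UNIV :: nat set set|" by (simp add: ordIso_iff_ordLeq)
  from ordIso_transitive[OF this ordIso_symmetric[OF continuum_ordIso]] show ?thesis
    unfolding num_countable_models_def Q_def .
qed

theorem theorem4p2:
  fixes T :: "fm set"
  assumes "FLD1_theory TYPE('a) T"
    and "has_VC_sharp_decomposition TYPE('b) T"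
  shows "VC_sharp_theory T"
proof -
  have T: "complete_theory T"
    using assms(1) by (simp add: FLD1_theory_def complete_po_theory_def)
  obtain M :: "'b struct" and J :: "nat struct" and X where MT: "M \<in> models T"
    and dec: "FLD1_decomposition M J X"
    and VC: "\<And>i. i \<in> fst J \<Longrightarrow> VC_sharp (induced M (X i))"
    using assms(2) unfolding has_VC_sharp_decomposition_def VC_sharp_decomposition_def by blast
  define A where "A i = induced M (X i)" for i
  have J: "is_struct J" "antisym (snd J)" "finite (fst J)"
    using dec by (auto simp: FLD1_decomposition_def is_po_def partial_order_on_def)
  have "X i \<noteq> {}" if "i \<in> fst J" for i
    using dec that unfolding FLD1_decomposition_def by blast
  moreover have "X i \<inter> X j = {}" if "i \<in> fst J" "j \<in> fst J" "i \<noteq> j" for i j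
    using dec that unfolding FLD1_decomposition_def by blast
  ultimately have A: "disjoint_structs J A"
    by (simp add: disjoint_structs_def A_def induced_def is_struct_def)
  have stA: "is_struct (A i)" if "i \<in> fst J" for i
    using A that by (simp add: disjoint_structs_def)
  have "M = lex_sum J (\<lambda>i. induced M (X i))"
    using dec unfolding FLD1_decomposition_def by blast
  then have M: "M = lex_sum J A" by (simp add: A_def[abs_def])
  have largest: "has_largest (A i)" if "i \<in> fst J" for i
    using dec that unfolding FLD1_decomposition_def A_def by blast
  have stM: "is_struct M" using MT by (simp add: models_def)
  have mod: "models T = {N :: nat struct. is_struct N \<and> elem_equiv M N}"
    by (rule models_complete_theory[OF T MT])
  show ?thesis
  proof (cases "\<exists>i\<in>fst J. num_countable_models (Th (A i)) =o ctwo ^c natLeq")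
    case True
    then show ?thesis
      using continuum_models_lex_sum[OF J A largest] mod M
      unfolding VC_sharp_theory_def by blast
  next
    case False
    have "ryll_nardzewski (A i)" if i: "i \<in> fst J" for i
    proof (cases "finite (fst (A i))")
      case True
      then show ?thesis by (rule finite_imp_ryll_nardzewski[OF stA[OF i]])
    next
      case inf: False
      \<comment> \<open>VC-sharp leaves three options for a summand; being finite and having
        continuum many countable models are excluded here.\<close>
      then have one: "num_countable_models (Th (A i)) =o cone"
        using VC[OF i] False i by (auto simp: VC_sharp_def VC_sharp_theory_def A_def)
      have "isomorphic N1 N2"
        if "is_struct N1" "elem_equiv (A i) N1" "is_struct N2" "elem_equiv (A i) N2" for N1 N2 :: "nat struct"
        using num_countable_models_oneD[OF one, of N1 N2] that by (simp add: models_Th[OF stA[OF i]])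
      then show ?thesis using ex_nonisomorphic_models[OF stA[OF i]] by blast
    qed
    \<comment> \<open>Finitely many types in every summand give finitely many in the sum, so
      back-and-forth applies to any two countable models of \<open>T\<close>.\<close>
    then have RN: "ryll_nardzewski M" unfolding M by (rule ryll_nardzewski_lex_sum[OF J(1,3) A])
    have "isomorphic N N'" if "N \<in> models T" "N' \<in> models T" for N N' :: "nat struct"
    proof -
      have N: "is_struct N" "elem_equiv M N" and N': "is_struct N'" "elem_equiv M N'"
        using that by (auto simp: mod)
      have "elem_equiv N N'" using elem_equiv_trans[OF elem_equiv_sym[OF N(2)] N'(2)] .
      then show ?thesis
        using isomorphic_if_ryll_nardzewski[OF N(1) N'(1)] elem_equiv_ryll_nardzewski[OF stM N RN]
        by simp
    qed
    moreover have "models T \<noteq> ({} :: nat struct set)" using T by (simp add: complete_theory_def)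
    ultimately show ?thesis unfolding VC_sharp_theory_def
      by (intro disjI1 num_countable_models_oneI)
  qed
qed

end
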